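(* For $r\ge 4$, any $r$-ample simplicial complex $Y$ is simply connected. Moreover, any simplicial loop $\alpha:S^1\to Y$ with $n$ vertices (i.e. a simplicial map to $Y$ from a triangulation of the circle $S^1$ with $n$ vertices) in an $r$-ample complex $Y$ bounds a simplicial disc $\beta:D^2\to Y$ (i.e. $\beta$ is a simplicial map extending $\alpha$, defined on a triangulation of the disc $D^2$ extending the given triangulation of $S^1=\partial D^2$), where $D^2$ is a triangulation of the disc having $n$ boundary vertices, at most $\left\lceil\frac{n-3}{r-3}\right\rceil$ internal vertices and at most $\left\lceil\frac{n-3}{r-3}\right\rceil\cdot(r-1)+1$ triangles.
   Context: For a simplicial complex $X$, $V(X)$ is its vertex set; for $U\subseteq V(X)$, $X_U$ is the induced subcomplex on $U$ (vertex set $U$, whose simplices are exactly the simplices of $X$ with all vertices in $U$). For a vertex $v\in V(X)$, the link ${\rm lk}_X(v)$ is the subcomplex of $X$ formed by all simplices $\sigma$ of $X$ with $v\notin\sigma$ such that $\sigma\cup\{v\}$ is a simplex of $X$. Subcomplexes are allowed to be empty. For an integer $r\ge 1$, a nonempty simplicial complex $X$ is $r$-ample if for each subset $U\subseteq V(X)$ with $|U|\le r$ and for each subcomplex $A\subseteq X_U$ there exists a vertex $v\in V(X)\setminus U$ such that ${\rm lk}_X(v)\cap X_U=A$. A simplicial complex $Y$ is $m$-connected if for every triangulation of the $i$-dimensional sphere $S^i$ with $i\le m$ and for every simplicial map $\alpha:S^i\to Y$ there exist a triangulation of the disc $D^{i+1}$ extending the given triangulation of the sphere $S^i=\partial D^{i+1}$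 and a simplicial map $\beta:D^{i+1}\to Y$ extending $\alpha$. A 1-connected complex is also said to be simply connected.
   Formalization: For n = 3 the loop's image is required to be a simplex of Y: with 0 internal vertices and at most 1 triangle allowed, the stated bounds fail for an unfilled triangle, and every r-ample complex contains one; n ≥ 4 is unchanged. *)

theory Defs
  imports "HOL-Analysis.Analysis"
begin

text \<open>
  An abstract simplicial complex is the set of its \<^emph>\<open>nonempty\<close> simplices; every vertex
  occurs as a singleton. The empty simplex is not recorded, so the empty complex is \<open>{}\<close>,
  and the link of an isolated vertex is \<open>{}\<close>. Complexes may be infinite.
\<close>

definition simplicial_cpx :: "'a set set \<Rightarrow> bool" where
  "simplicial_cpx K \<longleftrightarrow>
     (\<forall>\<sigma>\<in>K. finite \<sigma> \<and> \<sigma> \<noteq> {} \<and> (\<forall>\<tau>. \<tau> \<subseteq> \<sigma> \<and> \<tau> \<noteq> {} \<longrightarrow> \<tau> \<in> K))"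

definition vertex_set :: "'a set set \<Rightarrow> 'a set" where
  "vertex_set K = {v. {v} \<in> K}"

definition subcomplex :: "'a set set \<Rightarrow> 'a set set \<Rightarrow> bool" where
  "subcomplex A K \<longleftrightarrow> simplicial_cpx A \<and> A \<subseteq> K"

definition induced_cpx :: "'a set set \<Rightarrow> 'a set \<Rightarrow> 'a set set" where
  "induced_cpx K U = {\<sigma> \<in> K. \<sigma> \<subseteq> U}"

definition link :: "'a set set \<Rightarrow> 'a \<Rightarrow> 'a set set" where
  "link K v = {\<sigma> \<in> K. v \<notin> \<sigma> \<and> insert v \<sigma> \<in> K}"

definition ample :: "nat \<Rightarrow> 'a set set \<Rightarrow> bool" where
  "ample r K \<longleftrightarrow> simplicial_cpx K \<and> K \<noteq> {} \<and>
     (\<forall>U A. U \<subseteq> vertex_set K \<and> finite U \<and> card U \<le> r \<and> subcomplex A (induced_cpx K U) \<longrightarrow>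
        (\<exists>v \<in> vertex_set K - U. link K v \<inter> induced_cpx K U = A))"

definition simplicial_map :: "'a set set \<Rightarrow> 'b set set \<Rightarrow> ('a \<Rightarrow> 'b) \<Rightarrow> bool" where
  "simplicial_map K L f \<longleftrightarrow> (\<forall>\<sigma>\<in>K. f ` \<sigma> \<in> L)"

text \<open>
  Geometric realization by barycentric coordinates, with the subspace topology of the product
  topology. This is the usual topology for finite complexes, the only ones it is applied to.
\<close>

definition realization :: "'a set set \<Rightarrow> ('a \<Rightarrow> real) topology" where
  "realization K = subtopology (powertop_real UNIV)
     {t. {v. t v \<noteq> 0} \<in> K \<and> (\<forall>v. 0 \<le> t v) \<and> (\<Sum>v | t v \<noteq> 0. t v) = 1}"

text \<open>The closed unit disc of dimension \<open>n\<close>, in the same ambient space as \<^const>\<open>nsphere\<close>.\<close>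

definition ndisc :: "nat \<Rightarrow> (nat \<Rightarrow> real) topology" where
  "ndisc n = subtopology (Euclidean_space n) {x. (\<Sum>i<n. (x i)\<^sup>2) \<le> 1}"

text \<open>
  The spaces triangulated below are compact, so their triangulations are finite and, up to
  renaming, have natural numbers as vertices; there are always unused numbers for new vertices.
\<close>

definition triangulates_sphere :: "nat \<Rightarrow> nat set set \<Rightarrow> bool" where
  "triangulates_sphere n S \<longleftrightarrow>
     simplicial_cpx S \<and> finite S \<and> realization S homeomorphic_space nsphere n"

text \<open>
  \<open>D\<close> triangulates the disc of dimension \<open>n + 1\<close>, and its subcomplex \<open>S\<close> is the induced
  triangulation of the boundary sphere.
\<close>

definition disc_extending :: "nat \<Rightarrow> nat set set \<Rightarrow> nat set set \<Rightarrow> bool" where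
  "disc_extending n S D \<longleftrightarrow>
     simplicial_cpx D \<and> finite D \<and> subcomplex S D \<and>
     (\<exists>h. homeomorphic_map (realization D) (ndisc (Suc n)) h \<and>
          h ` topspace (realization S) = topspace (nsphere n))"

definition m_connected :: "nat \<Rightarrow> 'a set set \<Rightarrow> bool" where
  "m_connected m Y \<longleftrightarrow>
     (\<forall>i\<le>m. \<forall>S \<alpha>. triangulates_sphere i S \<and> simplicial_map S Y \<alpha> \<longrightarrow>
        (\<exists>D \<beta>. disc_extending i S D \<and> simplicial_map D Y \<beta> \<and>
               (\<forall>v\<in>vertex_set S. \<beta> v = \<alpha> v)))"

definition simply_connected_cpx :: "'a set set \<Rightarrow> bool" where
  "simply_connected_cpx Y \<longleftrightarrow> m_connected 1 Y"

end

theory Submission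
  imports Defs
begin

text \<open>
  If \<open>n \<le> r\<close>, ampleness provides a vertex of \<open>Y\<close> whose link contains the whole loop, and the loop
  bounds the cone with that apex. If \<open>n > r\<close>, cone off an arc of \<open>r\<close> consecutive vertices from a
  new vertex: this uses \<open>r - 1\<close> triangles and leaves a loop with \<open>n - (r - 3) \<ge> 4\<close> vertices. A
  circle complex is a cycle because the circle has no proper subspace homeomorphic to itself
  and removing one point does not disconnect it, so there are no triangles and no vertices of
  degree at most one.
\<close>

section \<open>Realizations as subsets of a function space\<close>

text \<open>An arc of \<open>r\<close> vertices has \<open>r - 2\<close> inner ones, and a fan
  replaces them by its single apex, hence the step \<open>r - 3\<close>. The last cone may have
  \<open>r = (r - 1) + 1\<close> triangles, the origin of the final \<open>+ 1\<close>. Ampleness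
  enters in one short step only; the work is topological. Since \<open>disc_extending\<close> asks
  for a homeomorphism of the realization with the round disc, both building moves, the cone over a
  whole loop and the fan along a boundary arc, need explicit homeomorphisms. For the fan this works
  only if the smaller disc meets it exactly in the two edges that join the apex to the ends of the
  arc. A filling must therefore be able to avoid a prescribed finite set of vertices, among them the
  vertices deleted from the arc.\<close>

definition geom :: "'a set set \<Rightarrow> ('a \<Rightarrow> real) set" where
  "geom K = {t. {v. t v \<noteq> 0} \<in> K \<and> (\<forall>v. 0 \<le> t v) \<and> (\<Sum>v | t v \<noteq> 0. t v) = 1}"

definition usphere :: "nat \<Rightarrow> (nat \<Rightarrow> real) set" where
  "usphere n = {x. (\<forall>i>n. x i = 0) \<and> (\<Sum>i\<le>n. (x i)\<^sup>2) = 1}"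

definition udisc :: "nat \<Rightarrow> (nat \<Rightarrow> real) set" where
  "udisc n = {x. (\<forall>i\<ge>n. x i = 0) \<and> (\<Sum>i<n. (x i)\<^sup>2) \<le> 1}"

lemma realization_geom: "realization K = top_of_set (geom K)"
  by (simp add: realization_def euclidean_product_topology geom_def)

lemma nsphere_usphere: "nsphere n = top_of_set (usphere n)"
  by (simp add: nsphere euclidean_product_topology usphere_def)
     (simp add: conj_commute)

lemma ndisc_udisc: "ndisc n = top_of_set (udisc n)"
  by (simp add: ndisc_def Euclidean_space_def euclidean_product_topology udisc_def
      subtopology_subtopology Collect_conj_eq)

text \<open>Any simplex that carries the support will do in place of the support itself: weights of
  sum 1 have nonempty support, which is then a face.\<close>

lemma geom_iff:
  assumes "simplicial_cpx K"
  shows "t \<in> geom K \<longleftrightarrow> (\<exists>\<sigma>\<in>K. (\<forall>v. 0 \<le> t v) \<and> (\<forall>v. v \<notin> \<sigma> \<longrightarrow> t v = 0) \<and> sum t \<sigma> = 1)"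
proof
  assume "t \<in> geom K"
  then show "\<exists>\<sigma>\<in>K. (\<forall>v. 0 \<le> t v) \<and> (\<forall>v. v \<notin> \<sigma> \<longrightarrow> t v = 0) \<and> sum t \<sigma> = 1"
    unfolding geom_def by (intro bexI[of _ "{v. t v \<noteq> 0}"]) auto
next
  assume "\<exists>\<sigma>\<in>K. (\<forall>v. 0 \<le> t v) \<and> (\<forall>v. v \<notin> \<sigma> \<longrightarrow> t v = 0) \<and> sum t \<sigma> = 1"
  then obtain \<sigma> where \<sigma>: "\<sigma> \<in> K" "\<forall>v. 0 \<le> t v" "\<forall>v. v \<notin> \<sigma> \<longrightarrow> t v = 0" "sum t \<sigma> = 1" by blast
  have fin: "finite \<sigma>" using assms \<sigma>(1) by (auto simp: simplicial_cpx_def)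
  have sub: "{v. t v \<noteq> 0} \<subseteq> \<sigma>" using \<sigma>(3) by auto
  have s: "(\<Sum>v | t v \<noteq> 0. t v) = sum t \<sigma>"
    by (rule sum.mono_neutral_left[OF fin sub]) auto
  then have "{v. t v \<noteq> 0} \<noteq> {}" using \<sigma>(4) by (metis sum.empty zero_neq_one)
  then have "{v. t v \<noteq> 0} \<in> K" using assms \<sigma>(1) sub unfolding simplicial_cpx_def by blast
  then show "t \<in> geom K" using s \<sigma> by (simp add: geom_def)
qed

lemma geomI:
  assumes "simplicial_cpx K" "\<sigma> \<in> K" "\<And>v. 0 \<le> t v" "\<And>v. v \<notin> \<sigma> \<Longrightarrow> t v = 0" "sum t \<sigma> = 1"
  shows "t \<in> geom K"
  using assms geom_iff by blast

lemma geom_nonneg: "t \<in> geom K \<Longrightarrow> 0 \<le> t v"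
  by (auto simp: geom_def)

lemma geom_support: "t \<in> geom K \<Longrightarrow> {v. t v \<noteq> 0} \<in> K"
  by (auto simp: geom_def)

lemma geom_sum:
  assumes "t \<in> geom K" "finite V" "{v. t v \<noteq> 0} \<subseteq> V"
  shows "sum t V = 1"
proof -
  have "sum t V = (\<Sum>v | t v \<noteq> 0. t v)"
    by (rule sum.mono_neutral_right[OF assms(2,3)]) auto
  then show ?thesis using assms(1) by (simp add: geom_def)
qed

lemma geom_mono: "K \<subseteq> L \<Longrightarrow> geom K \<subseteq> geom L"
  by (auto simp: geom_def)

lemma geom_Un: "geom (K \<union> L) = geom K \<union> geom L"
  by (auto simp: geom_def)

lemma geom_Int: "geom K \<inter> geom L = geom (K \<inter> L)"
  by (auto simp: geom_def)

text \<open>Each closed simplex is closed in the cube of all functions into the unit interval, which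
  is compact by Tychonoff even with infinitely many coordinates; finitely many such simplices are
  united.\<close>

lemma compact_geom:
  fixes K :: "'a set set"
  assumes "simplicial_cpx K" "finite K"
  shows "compact (geom K)"
proof -
  have *: "compact {t. (\<forall>v. 0 \<le> t v) \<and> (\<forall>v. v \<notin> \<sigma> \<longrightarrow> t v = 0) \<and> sum t \<sigma> = (1::real)}" (is "compact ?C")
    if "\<sigma> \<in> K" for \<sigma>
  proof -
    have fin: "finite \<sigma>" using assms(1) that by (auto simp: simplicial_cpx_def)
    have "compact (PiE UNIV (\<lambda>_::'a. {0..1::real}))"
      using compactin_PiE[of "\<lambda>_. euclideanreal" "UNIV::'a set" "\<lambda>_. {0..1}"]
      by (simp add: euclidean_product_topology)
    moreover have "closed ?C"
    proof -
      have "?C = (\<Inter>v. {t. 0 \<le> t v}) \<inter> (\<Inter>v\<in>-\<sigma>. {t. t v = 0}) \<inter> {t. sum t \<sigma> = 1}" by auto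
      moreover have "closed {t :: 'a \<Rightarrow> real. 0 \<le> t v}" for v
        by (intro closed_Collect_le continuous_intros) auto
      moreover have "closed {t :: 'a \<Rightarrow> real. t v = 0}" for v
        by (intro closed_Collect_eq continuous_intros) auto
      moreover have "closed {t :: 'a \<Rightarrow> real. sum t \<sigma> = 1}"
        by (intro closed_Collect_eq continuous_intros) auto
      ultimately show ?thesis by (simp only:) (intro closed_Int closed_INT ballI)
    qed
    moreover have "?C \<subseteq> PiE UNIV (\<lambda>_::'a. {0..1::real})"
    proof
      fix t assume t: "t \<in> ?C"
      have "t v \<le> 1" for v
      proof (cases "v \<in> \<sigma>")
        case True
        then have "t v \<le> sum t \<sigma>" using t fin by (intro member_le_sum) auto
        then show ?thesis using t by auto
      next
        case False then show ?thesis using t by auto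
      qed
      then show "t \<in> PiE UNIV (\<lambda>_::'a. {0..1::real})" using t by auto
    qed
    ultimately have "compact (PiE UNIV (\<lambda>_::'a. {0..1::real}) \<inter> ?C)" by (intro compact_Int_closed)
    then show ?thesis using \<open>?C \<subseteq> _\<close> by (simp only: inf.absorb2)
  qed
  have "geom K = (\<Union>\<sigma>\<in>K. {t. (\<forall>v. 0 \<le> t v) \<and> (\<forall>v. v \<notin> \<sigma> \<longrightarrow> t v = 0) \<and> sum t \<sigma> = 1})"
    using geom_iff[OF assms(1)] by blast
  then show ?thesis using compact_UN[OF assms(2) *] by simp
qed

text \<open>Compact source and Hausdorff target make the inverse continuous, so the constructions
  below only check continuity, injectivity and image.\<close>

lemma homeomorphic_map_compact:
  fixes f :: "'a::topological_space \<Rightarrow> 'b::t2_space"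
  assumes "compact A" "continuous_on A f" "inj_on f A" "f ` A = B"
  shows "homeomorphic_map (top_of_set A) (top_of_set B) f"
proof -
  obtain g where "homeomorphism A B f g" using homeomorphism_compact[OF assms(1,2,4,3)] by blast
  then have "homeomorphic_maps (top_of_set A) (top_of_set B) f g"
    by (auto simp: homeomorphic_maps_def homeomorphism_def)
  then show ?thesis using homeomorphic_map_maps by blast
qed

lemma homeomorphic_mapD:
  assumes "homeomorphic_map (top_of_set A) (top_of_set B) f"
  shows "continuous_on A f" "inj_on f A" "f ` A = B"
  using assms by (auto simp: homeomorphic_eq_everything_map)

lemma triangulates_sphereI:
  assumes "simplicial_cpx S" "finite S" "continuous_on (geom S) f" "inj_on f (geom S)"
    "f ` geom S = usphere n"
  shows "triangulates_sphere n S"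
  using assms homeomorphic_map_compact[OF compact_geom[OF assms(1,2)] assms(3-5)]
  by (auto simp: triangulates_sphere_def realization_geom nsphere_usphere
      intro: homeomorphic_map_imp_homeomorphic_space)

lemma triangulates_sphereE:
  assumes "triangulates_sphere n S"
  obtains f where "continuous_on (geom S) f" "inj_on f (geom S)" "f ` geom S = usphere n"
  using assms unfolding triangulates_sphere_def realization_geom nsphere_usphere
  by (metis homeomorphic_mapD homeomorphic_space)

lemma disc_extendingI:
  assumes "simplicial_cpx D" "finite D" "subcomplex S D" "continuous_on (geom D) h"
    "inj_on h (geom D)" "h ` geom D = udisc (Suc n)" "h ` geom S = usphere n"
  shows "disc_extending n S D"
  using assms homeomorphic_map_compact[OF compact_geom[OF assms(1,2)] assms(4-6)]
  by (auto simp: disc_extending_def realization_geom nsphere_usphere ndisc_udisc)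

lemma disc_extendingE:
  assumes "disc_extending n S D"
  obtains h where "simplicial_cpx D" "finite D" "subcomplex S D" "continuous_on (geom D) h"
    "inj_on h (geom D)" "h ` geom D = udisc (Suc n)" "h ` geom S = usphere n"
  using assms homeomorphic_mapD
  by (auto simp: disc_extending_def realization_geom nsphere_usphere ndisc_udisc) blast

section \<open>Complex coordinates on the circle and the plane disc\<close>

definition emb :: "complex \<Rightarrow> nat \<Rightarrow> real" where
  "emb z = (\<lambda>i. if i = 0 then Re z else if i = 1 then Im z else 0)"

definition prj :: "(nat \<Rightarrow> real) \<Rightarrow> complex" where
  "prj x = Complex (x 0) (x 1)"

lemma prj_emb [simp]: "prj (emb z) = z"
  by (simp add: prj_def emb_def)

lemma inj_emb: "inj emb"
  by (metis injI prj_emb)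

lemma continuous_on_emb: "continuous_on A f \<Longrightarrow> continuous_on A (\<lambda>x. emb (f x))"
  unfolding emb_def
proof (rule continuous_on_coordinatewise_then_product)
  fix i assume "continuous_on A f"
  then show "continuous_on A (\<lambda>x. if i = 0 then Re (f x) else if i = 1 then Im (f x) else 0)"
    by (cases "i = 0"; cases "i = 1") (auto intro: continuous_intros)
qed

lemma continuous_on_prj: "continuous_on A prj"
proof -
  have "prj = (\<lambda>x. of_real (x 0) + \<i> * of_real (x 1))"
    by (auto simp: prj_def complex_eq_iff)
  moreover have "continuous_on A (\<lambda>x. of_real (x 0) + \<i> * of_real (x 1) :: complex)"
    by (intro continuous_intros continuous_on_subset[OF continuous_on_product_coordinates]) auto
  ultimately show ?thesis by (simp only:)
qed

lemma emb_sphere: "emb ` sphere 0 1 = usphere 1"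
proof
  show "emb ` sphere 0 1 \<subseteq> usphere 1"
    by (auto simp: emb_def usphere_def cmod_def)
  show "usphere 1 \<subseteq> emb ` sphere 0 1"
  proof
    fix x assume x: "x \<in> usphere 1"
    then have "x = emb (prj x)" by (auto simp: emb_def prj_def usphere_def)
    moreover have "prj x \<in> sphere 0 1" using x by (auto simp: prj_def usphere_def cmod_def)
    ultimately show "x \<in> emb ` sphere 0 1" by blast
  qed
qed

lemma emb_cball: "emb ` cball 0 1 = udisc 2"
proof
  show "emb ` cball 0 1 \<subseteq> udisc 2"
    by (auto simp: emb_def udisc_def cmod_def eval_nat_numeral)
  show "udisc 2 \<subseteq> emb ` cball 0 1"
  proof
    fix x assume x: "x \<in> udisc 2"
    then have "x = emb (prj x)" by (auto simp: emb_def prj_def udisc_def)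
    moreover have "prj x \<in> cball 0 1" using x by (auto simp: prj_def udisc_def cmod_def eval_nat_numeral)
    ultimately show "x \<in> emb ` cball 0 1" by blast
  qed
qed

lemma prj_usphere: "prj ` usphere 1 = sphere 0 1" "inj_on prj (usphere 1)"
  unfolding emb_sphere[symmetric] by (auto simp: image_image inj_on_def)

lemma prj_udisc: "prj ` udisc 2 = cball 0 1" "inj_on prj (udisc 2)"
  unfolding emb_cball[symmetric] by (auto simp: image_image inj_on_def)

text \<open>Circle and plane disc are moved to the complex numbers, where \<open>sgn\<close>,
  \<open>cis\<close> and \<open>Arg2pi\<close> serve as polar coordinates.\<close>

lemma triangulates_circleI:
  assumes "simplicial_cpx S" "finite S" "continuous_on (geom S) f" "inj_on f (geom S)"
    "f ` geom S = sphere (0::complex) 1"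
  shows "triangulates_sphere 1 S"
proof (rule triangulates_sphereI[of S "emb \<circ> f"])
  show "inj_on (emb \<circ> f) (geom S)" using assms inj_emb by (meson comp_inj_on inj_on_subset subset_UNIV)
  show "(emb \<circ> f) ` geom S = usphere 1" by (metis assms(5) emb_sphere image_comp)
qed (use assms continuous_on_emb in \<open>auto simp: o_def\<close>)

lemma triangulates_circleE:
  assumes "triangulates_sphere 1 S"
  obtains f where "continuous_on (geom S) f" "inj_on f (geom S)" "f ` geom S = sphere (0::complex) 1"
proof -
  obtain f where f: "continuous_on (geom S) f" "inj_on f (geom S)" "f ` geom S = usphere 1"
    using triangulates_sphereE[OF assms] .
  show ?thesis
  proof (rule that[of "prj \<circ> f"])
    show "continuous_on (geom S) (prj \<circ> f)" using f continuous_on_prj continuous_on_compose by blast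
    show "inj_on (prj \<circ> f) (geom S)" using f prj_usphere by (metis comp_inj_on)
    show "(prj \<circ> f) ` geom S = sphere 0 1" by (metis f(3) image_comp prj_usphere(1))
  qed
qed

lemma disc_extending_1I:
  assumes "simplicial_cpx D" "finite D" "subcomplex S D" "continuous_on (geom D) h"
    "inj_on h (geom D)" "h ` geom D = cball (0::complex) 1" "h ` geom S = sphere 0 1"
  shows "disc_extending 1 S D"
proof (rule disc_extendingI[of D S "emb \<circ> h"])
  show "inj_on (emb \<circ> h) (geom D)" using assms inj_emb by (meson comp_inj_on inj_on_subset subset_UNIV)
  show "(emb \<circ> h) ` geom S = usphere 1" by (metis assms(7) emb_sphere image_comp)
  show "(emb \<circ> h) ` geom D = udisc (Suc 1)" by (metis assms(6) emb_cball image_comp Suc_1)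
qed (use assms continuous_on_emb in \<open>auto simp: o_def\<close>)

lemma disc_extending_1E:
  assumes "disc_extending 1 S D"
  obtains h where "simplicial_cpx D" "finite D" "subcomplex S D" "continuous_on (geom D) h"
    "inj_on h (geom D)" "h ` geom D = cball (0::complex) 1" "h ` geom S = sphere 0 1"
proof -
  obtain h where h: "simplicial_cpx D" "finite D" "subcomplex S D" "continuous_on (geom D) h"
    "inj_on h (geom D)" "h ` geom D = udisc 2" "h ` geom S = usphere 1"
    using disc_extendingE[OF assms] by (metis Suc_1)
  show ?thesis
  proof (rule that[of "prj \<circ> h"])
    show "continuous_on (geom D) (prj \<circ> h)" using h continuous_on_prj continuous_on_compose by blast
    show "inj_on (prj \<circ> h) (geom D)" using h prj_udisc by (metis comp_inj_on)
    show "(prj \<circ> h) ` geom S = sphere 0 1" by (metis h(7) image_comp prj_usphere(1))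
    show "(prj \<circ> h) ` geom D = cball 0 1" by (metis h(6) image_comp prj_udisc(1))
  qed (use h in auto)
qed

section \<open>Cones\<close>

text \<open>Continuity of polar formulas at the centre, where the direction \<open>g\<close> has no
  limit: there the product is squeezed by \<open>|s|\<close>. Elsewhere the set
  \<open>s x \<noteq> 0\<close> is relatively open, so continuity of \<open>g\<close> on it is
  enough.\<close>

lemma continuous_on_scaleR_bounded:
  fixes g :: "'a::topological_space \<Rightarrow> 'b::real_normed_vector"
  assumes s: "continuous_on A s" and g: "continuous_on {x \<in> A. s x \<noteq> 0} g"
    and bd: "\<And>x. x \<in> A \<Longrightarrow> s x \<noteq> 0 \<Longrightarrow> norm (g x) \<le> 1"
  shows "continuous_on A (\<lambda>x. s x *\<^sub>R g x)"
  unfolding continuous_on_def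
proof
  fix x assume x: "x \<in> A"
  have sx: "(s \<longlongrightarrow> s x) (at x within A)" using s x by (auto simp: continuous_on_def)
  show "((\<lambda>x. s x *\<^sub>R g x) \<longlongrightarrow> s x *\<^sub>R g x) (at x within A)"
  proof (cases "s x = 0")
    case True
    have "((\<lambda>x. s x *\<^sub>R g x) \<longlongrightarrow> 0) (at x within A)"
    proof (rule Lim_null_comparison)
      show "((\<lambda>x. \<bar>s x\<bar>) \<longlongrightarrow> 0) (at x within A)" using sx True by (simp add: tendsto_rabs_zero)
      show "\<forall>\<^sub>F y in at x within A. norm (s y *\<^sub>R g y) \<le> \<bar>s y\<bar>"
        unfolding eventually_at_filter
      proof (rule always_eventually, intro allI impI)
        fix y assume "y \<in> A"
        then show "norm (s y *\<^sub>R g y) \<le> \<bar>s y\<bar>"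
          using bd[of y] by (cases "s y = 0") (auto simp: mult_left_le)
      qed
    qed
    then show ?thesis using True by simp
  next
    case False
    have "(g \<longlongrightarrow> g x) (at x within {x \<in> A. s x \<noteq> 0})"
      using g x False by (auto simp: continuous_on_def)
    moreover have "openin (top_of_set A) {x \<in> A. s x \<noteq> 0}"
      using continuous_openin_preimage_gen[OF s, of "-{0}"] by (auto simp: vimage_def Int_def)
    then obtain T where "open T" "{x \<in> A. s x \<noteq> 0} = A \<inter> T" by (auto simp: openin_open)
    then have "at x within {x \<in> A. s x \<noteq> 0} = at x within A"
      using x False by (intro at_within_nhd[of x T]) auto
    ultimately have "(g \<longlongrightarrow> g x) (at x within A)" by simp
    then show ?thesis using sx by (intro tendsto_intros)
  qed
qed

text \<open>
  The level \<open>s\<close> and the projection \<open>p\<close> exhibit \<open>geom D\<close> as a topological cone over \<open>geom S\<close> with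
  apex \<open>x0\<close>; then \<open>x \<mapsto> s x \<cdot> f (p x)\<close> extends a homeomorphism \<open>f\<close> of \<open>geom S\<close> with the sphere.
\<close>

lemma disc_extending_radial:
  fixes s :: "(nat \<Rightarrow> real) \<Rightarrow> real" and p :: "(nat \<Rightarrow> real) \<Rightarrow> nat \<Rightarrow> real"
  assumes D: "simplicial_cpx D" "finite D" "subcomplex S D" and S: "triangulates_sphere n S"
    and s: "continuous_on (geom D) s" "\<And>x. x \<in> geom D \<Longrightarrow> 0 \<le> s x \<and> s x \<le> 1"
    and p: "continuous_on {x \<in> geom D. s x \<noteq> 0} p"
      "\<And>x. x \<in> geom D \<Longrightarrow> s x \<noteq> 0 \<Longrightarrow> p x \<in> geom S"
    and centre: "x0 \<in> geom D" "\<And>x. x \<in> geom D \<Longrightarrow> s x = 0 \<longleftrightarrow> x = x0"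
    and inj: "\<And>x y. x \<in> geom D \<Longrightarrow> y \<in> geom D \<Longrightarrow> s x \<noteq> 0 \<Longrightarrow> s x = s y \<Longrightarrow> p x = p y \<Longrightarrow> x = y"
    and surj: "\<And>c y. 0 < c \<Longrightarrow> c \<le> 1 \<Longrightarrow> y \<in> geom S \<Longrightarrow> \<exists>x\<in>geom D. s x = c \<and> p x = y"
    and bdry: "\<And>y. y \<in> geom S \<Longrightarrow> s y = 1 \<and> p y = y"
  shows "disc_extending n S D"
proof -
  obtain f where f: "continuous_on (geom S) f" "inj_on f (geom S)" "f ` geom S = usphere n"
    using triangulates_sphereE[OF S] .
  define h where "h x = (\<lambda>i. s x * f (p x) i)" for x
  have us: "(\<Sum>i\<le>n. (f y i)\<^sup>2) = 1" "i > n \<Longrightarrow> f y i = 0" if "y \<in> geom S" for y i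
    using f(3) that by (auto simp: usphere_def)
  have f1: "\<bar>f y i\<bar> \<le> 1" if "y \<in> geom S" for y i
  proof (cases "i \<le> n")
    case True
    then have "(f y i)\<^sup>2 \<le> (\<Sum>i\<le>n. (f y i)\<^sup>2)" by (intro member_le_sum) auto
    then show ?thesis using us[OF that] by (simp add: abs_square_le_1)
  qed (use us[OF that] in auto)
  \<comment> \<open>The Euclidean norm of \<open>h x\<close> is the level, so \<open>h x\<close>
    determines \<open>s x\<close> and, off the apex, also \<open>f (p x)\<close>.\<close>
  have sumh: "(\<Sum>i\<le>n. (h x i)\<^sup>2) = (s x)\<^sup>2" if "x \<in> geom D" for x
  proof (cases "s x = 0")
    case False
    then show ?thesis using us(1)[OF p(2)[OF that False]]
      by (simp add: h_def power_mult_distrib sum_distrib_left[symmetric])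
  qed (simp add: h_def)
  have SD: "geom S \<subseteq> geom D" using D(3) by (simp add: subcomplex_def geom_mono)
  have 1: "continuous_on (geom D) h"
  proof (rule continuous_on_coordinatewise_then_product)
    fix i
    have "continuous_on {x \<in> geom D. s x \<noteq> 0} (\<lambda>x. f (p x))"
      by (rule continuous_on_compose2[OF f(1) p(1)]) (use p(2) in auto)
    then have "continuous_on {x \<in> geom D. s x \<noteq> 0} (\<lambda>x. f (p x) i)"
      by (rule continuous_on_product_then_coordinatewise)
    then have "continuous_on (geom D) (\<lambda>x. s x *\<^sub>R f (p x) i)"
      by (intro continuous_on_scaleR_bounded s) (use f1 p(2) in auto)
    then show "continuous_on (geom D) (\<lambda>x. h x i)" by (simp add: h_def)
  qed
  have 2: "inj_on h (geom D)"
  proof (rule inj_onI)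
    fix x y assume xy: "x \<in> geom D" "y \<in> geom D" "h x = h y"
    have "(s x)\<^sup>2 = (s y)\<^sup>2" using sumh xy by metis
    then have sxy: "s x = s y" using s(2) xy by simp
    show "x = y"
    proof (cases "s x = 0")
      case True
      then show ?thesis using centre xy sxy by metis
    next
      case False
      have "f (p x) i = f (p y) i" for i
        using fun_cong[OF xy(3), of i] False sxy by (simp add: h_def)
      then have "f (p x) = f (p y)" by blast
      then have "p x = p y" using f(2) p(2) xy False sxy by (metis inj_onD)
      then show ?thesis using inj xy sxy False by blast
    qed
  qed
  have 3: "h ` geom D \<subseteq> udisc (Suc n)"
  proof
    fix z assume "z \<in> h ` geom D"
    then obtain x where x: "x \<in> geom D" "z = h x" by auto
    have "(s x)\<^sup>2 \<le> 1" using s(2)[OF x(1)] by (simp add: power_le_one)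
    moreover have "h x i = 0" if "i \<ge> Suc n" for i
      using us(2)[OF p(2)[OF x(1)], of i] that by (cases "s x = 0") (auto simp: h_def)
    ultimately show "z \<in> udisc (Suc n)"
      using sumh[OF x(1)] x(2) by (simp add: udisc_def lessThan_Suc_atMost)
  qed
  have 4: "udisc (Suc n) \<subseteq> h ` geom D"
  proof
    fix z assume z: "z \<in> udisc (Suc n)"
    \<comment> \<open>The level of the preimage is the norm of \<open>z\<close>; the direction
      \<open>z / c\<close> determines its projection.\<close>
    define c where "c = sqrt (\<Sum>i\<le>n. (z i)\<^sup>2)"
    have c: "0 \<le> c" "c \<le> 1" "c\<^sup>2 = (\<Sum>i\<le>n. (z i)\<^sup>2)"
      using z by (auto simp: c_def udisc_def lessThan_Suc_atMost sum_nonneg)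
    have z0: "z i = 0" if "i > n" for i using z that by (auto simp: udisc_def)
    show "z \<in> h ` geom D"
    proof (cases "c = 0")
      case True
      then have "\<forall>i\<in>{..n}. (z i)\<^sup>2 = 0" using c(3) by (subst sum_nonneg_eq_0_iff[symmetric]) auto
      then have "z i = 0" for i using z0[of i] by (cases "i \<le> n") auto
      then have "z = h x0" using centre by (auto simp: h_def)
      then show ?thesis using centre by blast
    next
      case False
      have "(\<lambda>i. z i / c) \<in> usphere n" using False c(3) z0
        by (auto simp: usphere_def power_divide sum_divide_distrib[symmetric])
      then obtain y where y: "y \<in> geom S" "f y = (\<lambda>i. z i / c)" using f(3) by (metis imageE)
      obtain x where x: "x \<in> geom D" "s x = c" "p x = y" using surj[of c y] y c False by auto
      have "h x = z" using x y False by (auto simp: h_def)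
      then show ?thesis using x by blast
    qed
  qed
  have "h y = f y" if "y \<in> geom S" for y using bdry[OF that] by (simp add: h_def)
  then have "h ` geom S = usphere n" using f(3) by simp
  then show ?thesis using disc_extendingI[OF D 1 2] 3 4 by blast
qed

section \<open>Abstract cones and their join coordinates\<close>

lemma simplicial_cpx_face:
  "simplicial_cpx K \<Longrightarrow> \<sigma> \<in> K \<Longrightarrow> \<tau> \<subseteq> \<sigma> \<Longrightarrow> \<tau> \<noteq> {} \<Longrightarrow> \<tau> \<in> K"
  unfolding simplicial_cpx_def by blast

lemma simplicial_cpx_finite: "simplicial_cpx K \<Longrightarrow> \<sigma> \<in> K \<Longrightarrow> finite \<sigma>"
  unfolding simplicial_cpx_def by blast

lemma finite_vertex_set: "simplicial_cpx K \<Longrightarrow> finite K \<Longrightarrow> finite (vertex_set K)"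
  using finite_subset[of "vertex_set K" "\<Union>K"] simplicial_cpx_finite
  unfolding vertex_set_def by blast

text \<open>The apex is listed separately: it would be the cone over the empty simplex, which
  complexes here do not record.\<close>

definition cone_cpx :: "'a \<Rightarrow> 'a set set \<Rightarrow> 'a set set" where
  "cone_cpx w L = insert {w} (L \<union> insert w ` L)"

lemma simplicial_cone_cpx:
  assumes "simplicial_cpx L"
  shows "simplicial_cpx (cone_cpx w L)"
  unfolding simplicial_cpx_def
proof (intro ballI conjI allI impI)
  fix \<sigma> assume s: "\<sigma> \<in> cone_cpx w L"
  show "finite \<sigma>" "\<sigma> \<noteq> {}" using s assms by (auto simp: cone_cpx_def simplicial_cpx_def)
  fix \<tau> assume t: "\<tau> \<subseteq> \<sigma> \<and> \<tau> \<noteq> {}"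
  show "\<tau> \<in> cone_cpx w L"
  proof (cases "\<sigma> \<in> L")
    case True
    then have "\<tau> \<in> L" using t simplicial_cpx_face[OF assms] by blast
    then show ?thesis by (simp add: cone_cpx_def)
  next
    case False
    then have "\<tau> - {w} = {} \<or> (\<exists>\<rho>\<in>L. \<tau> - {w} \<subseteq> \<rho>)" using s t by (auto simp: cone_cpx_def)
    then consider "\<tau> - {w} = {}" | "\<tau> - {w} \<in> L" using simplicial_cpx_face[OF assms] by blast
    then show ?thesis
    proof cases
      case 1
      then have "\<tau> = {w}" using t by auto
      then show ?thesis by (simp add: cone_cpx_def)
    next
      case 2
      then show ?thesis by (cases "w \<in> \<tau>") (auto simp: cone_cpx_def insert_absorb image_iff intro!: bexI[of _ "\<tau> - {w}"])
    qed
  qed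
qed

lemma finite_cone_cpx: "finite L \<Longrightarrow> finite (cone_cpx w L)"
  by (simp add: cone_cpx_def)

lemma simplex_in_vertex_set: "simplicial_cpx K \<Longrightarrow> \<sigma> \<in> K \<Longrightarrow> \<sigma> \<subseteq> vertex_set K"
  unfolding vertex_set_def using simplicial_cpx_face[of K \<sigma>] by blast

lemma geom_vertex_zero: "simplicial_cpx K \<Longrightarrow> x \<in> geom K \<Longrightarrow> v \<notin> vertex_set K \<Longrightarrow> x v = 0"
  using simplex_in_vertex_set geom_support by fastforce

text \<open>Join coordinates: the point on the segment from the apex to \<open>y\<close> that
  carries weight \<open>c\<close> on \<open>y\<close>.\<close>

lemma cone_point:
  assumes L: "simplicial_cpx L" "w \<notin> vertex_set L" and y: "y \<in> geom L" and c: "0 \<le> c" "c \<le> 1"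
  shows "(\<lambda>i. if i = w then 1 - c else c * y i) \<in> geom (cone_cpx w L)"
proof -
  obtain \<sigma> where \<sigma>: "\<sigma> \<in> L" "\<And>v. 0 \<le> y v" "\<And>v. v \<notin> \<sigma> \<Longrightarrow> y v = 0" "sum y \<sigma> = 1"
    using y geom_iff[OF L(1)] by blast
  have w: "w \<notin> \<sigma>" "finite \<sigma>" using L \<sigma>(1) simplex_in_vertex_set simplicial_cpx_finite by blast+
  have "(\<Sum>i\<in>\<sigma>. if i = w then 1 - c else c * y i) = (\<Sum>i\<in>\<sigma>. c * y i)"
    using w by (intro sum.cong) auto
  also have "\<dots> = c" using \<sigma>(4) by (simp add: sum_distrib_left[symmetric])
  finally show ?thesis using c \<sigma> w
    by (intro geomI[OF simplicial_cone_cpx[OF L(1)], of "insert w \<sigma>"]) (auto simp: cone_cpx_def)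
qed

text \<open>Inverse of the join coordinates: deleting the weight at \<open>w\<close> and rescaling
  the rest to total weight 1 gives the base point, which is defined except at the apex.\<close>

lemma cone_base:
  assumes L: "simplicial_cpx L" "w \<notin> vertex_set L" and x: "x \<in> geom (cone_cpx w L)"
  shows "0 \<le> x w" "x w \<le> 1" "x w \<noteq> 1 \<Longrightarrow> (\<lambda>i. if i = w then 0 else x i / (1 - x w)) \<in> geom L"
    "x w = 1 \<Longrightarrow> x = (\<lambda>i. if i = w then 1 else 0)"
proof -
  define \<sigma> where "\<sigma> = {v. x v \<noteq> 0}"
  have \<sigma>: "\<sigma> \<in> cone_cpx w L" using geom_support[OF x] by (simp add: \<sigma>_def)
  have fin: "finite (\<sigma> - {w})" using simplicial_cpx_finite[OF simplicial_cone_cpx[OF L(1)] \<sigma>] by simp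
  have nn: "0 \<le> x v" for v using geom_nonneg[OF x] .
  have "sum x (insert w (\<sigma> - {w})) = 1"
    by (rule geom_sum[OF x]) (use fin in \<open>auto simp: \<sigma>_def\<close>)
  moreover have "sum x (insert w (\<sigma> - {w})) = x w + sum x (\<sigma> - {w})"
    by (rule sum.insert) (use fin in auto)
  ultimately have s: "x w + sum x (\<sigma> - {w}) = 1" by linarith
  show "0 \<le> x w" using nn .
  have "0 \<le> sum x (\<sigma> - {w})" using nn by (simp add: sum_nonneg)
  then show "x w \<le> 1" using s by simp
  show "x = (\<lambda>i. if i = w then 1 else 0)" if "x w = 1"
  proof -
    have "\<forall>v\<in>\<sigma> - {w}. x v = 0" using s that nn fin sum_nonneg_eq_0_iff[of "\<sigma> - {w}" x] by simp
    then show ?thesis using that by (auto simp: \<sigma>_def fun_eq_iff)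
  qed
  assume ne: "x w \<noteq> 1"
  then have "\<sigma> - {w} \<noteq> {}" using s by (metis add.right_neutral sum.empty)
  then have "\<sigma> - {w} \<in> L"
  proof -
    have "\<sigma> \<noteq> {w}" using \<open>\<sigma> - {w} \<noteq> {}\<close> by auto
    then consider "\<sigma> \<in> L" | \<tau> where "\<tau> \<in> L" "\<sigma> = insert w \<tau>" using \<sigma> by (auto simp: cone_cpx_def)
    then show ?thesis
    proof cases
      case 1
      then have "w \<notin> \<sigma>" using simplex_in_vertex_set[OF L(1)] L(2) by blast
      then show ?thesis using 1 by simp
    next
      case 2
      then have "w \<notin> \<tau>" using simplex_in_vertex_set[OF L(1)] L(2) by blast
      then show ?thesis using 2 by simp
    qed
  qed
  then show "(\<lambda>i. if i = w then 0 else x i / (1 - x w)) \<in> geom L"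
  proof (rule geomI[OF L(1)])
    fix v show "0 \<le> (if v = w then 0 else x v / (1 - x w))" using nn \<open>x w \<le> 1\<close> by simp
    show "v \<notin> \<sigma> - {w} \<Longrightarrow> (if v = w then 0 else x v / (1 - x w)) = 0" by (auto simp: \<sigma>_def)
    have "(\<Sum>i\<in>\<sigma> - {w}. if i = w then 0 else x i / (1 - x w)) = (\<Sum>i\<in>\<sigma> - {w}. x i / (1 - x w))"
      by (intro sum.cong) auto
    also have "\<dots> = 1" using s ne by (simp add: sum_divide_distrib[symmetric])
    finally show "(\<Sum>i\<in>\<sigma> - {w}. if i = w then 0 else x i / (1 - x w)) = 1" .
  qed
qed

lemma continuous_on_coord: "continuous_on A (\<lambda>x::'a \<Rightarrow> real. x i)"
  by (rule continuous_on_subset[OF continuous_on_product_coordinates]) simp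

text \<open>Radial data from join coordinates: the level is the weight \<open>1 - x w\<close> off
  the apex, and \<open>p\<close> projects away from the apex. Being independent of the dimension,
  the construction fills both loops and pairs of points.\<close>

lemma disc_extending_cone:
  fixes S :: "nat set set"
  assumes S: "triangulates_sphere n S" and w: "w \<notin> vertex_set S"
  shows "disc_extending n S (cone_cpx w S)"
proof -
  have cS: "simplicial_cpx S" "finite S" using S by (auto simp: triangulates_sphere_def)
  define p where "p x = (\<lambda>i. if i = w then 0 else x i / (1 - x w))" for x :: "nat \<Rightarrow> real"
  show ?thesis
  proof (rule disc_extending_radial[where s = "\<lambda>x. 1 - x w" and p = p and ?x0.0 = "\<lambda>i. if i = w then 1 else 0"])
    show "simplicial_cpx (cone_cpx w S)" "finite (cone_cpx w S)" "triangulates_sphere n S"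
      using cS simplicial_cone_cpx finite_cone_cpx S by auto
    show sub: "subcomplex S (cone_cpx w S)" using cS by (auto simp: subcomplex_def cone_cpx_def)
    show "continuous_on (geom (cone_cpx w S)) (\<lambda>x. 1 - x w)"
      by (intro continuous_intros continuous_on_coord)
    show "continuous_on {x \<in> geom (cone_cpx w S). 1 - x w \<noteq> 0} p"
      unfolding p_def
    proof (rule continuous_on_coordinatewise_then_product)
      fix i show "continuous_on {x \<in> geom (cone_cpx w S). 1 - x w \<noteq> 0} (\<lambda>x. if i = w then 0 else x i / (1 - x w))"
        by (cases "i = w") (auto intro!: continuous_intros continuous_on_coord)
    qed
    show "(\<lambda>i. if i = w then 1 else 0) \<in> geom (cone_cpx w S)"
      by (rule geomI[OF simplicial_cone_cpx[OF cS(1)], of "{w}"]) (auto simp: cone_cpx_def)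
    fix x assume x: "x \<in> geom (cone_cpx w S)"
    note cb = cone_base[OF cS(1) w x]
    show "0 \<le> 1 - x w \<and> 1 - x w \<le> 1" using cb by auto
    show "1 - x w \<noteq> 0 \<Longrightarrow> p x \<in> geom S" using cb by (auto simp: p_def)
    show "1 - x w = 0 \<longleftrightarrow> x = (\<lambda>i. if i = w then 1 else 0)" using cb by auto
    fix y assume "1 - x w \<noteq> 0" "1 - x w = 1 - y w" "p x = p y"
    then show "x = y" by (auto simp: p_def fun_eq_iff split: if_splits)
  next
    fix c y assume c: "(0::real) < c" "c \<le> 1" and y: "y \<in> geom S"
    have "y w = 0" using geom_vertex_zero[OF cS(1) y w] .
    then have "p (\<lambda>i. if i = w then 1 - c else c * y i) = y" using c by (auto simp: p_def)
    then show "\<exists>x\<in>geom (cone_cpx w S). 1 - x w = c \<and> p x = y"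
      using cone_point[OF cS(1) w y] c by (intro bexI[of _ "\<lambda>i. if i = w then 1 - c else c * y i"]) auto
  next
    fix y assume y: "y \<in> geom S"
    have "y w = 0" using geom_vertex_zero[OF cS(1) y w] .
    then show "1 - y w = 1 \<and> p y = y" by (auto simp: p_def)
  qed
qed

text \<open>The full triangle is a cone over its boundary with the barycentre as apex. Unlike
  \<open>cone_cpx\<close> this adds no vertex, as required when a loop has three vertices and no
  internal vertex is allowed.\<close>

lemma disc_extending_triangle:
  fixes a b c :: nat
  assumes ne: "a \<noteq> b" "a \<noteq> c" "b \<noteq> c"
  assumes S: "triangulates_sphere n (Pow {a,b,c} - {{}, {a,b,c}})" (is "triangulates_sphere n ?S")
  shows "disc_extending n ?S (Pow {a,b,c} - {{}})" (is "disc_extending n _ ?D")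
proof -
  have cS: "simplicial_cpx ?S" "finite ?S" using S by (auto simp: triangulates_sphere_def)
  have cD: "simplicial_cpx ?D" using finite_subset by (auto simp: simplicial_cpx_def)
  \<comment> \<open>Moving away from the barycentre lowers the least coordinate, and the boundary is
    reached when it is 0. Subtracting \<open>m x\<close> from all three coordinates leaves total
    weight \<open>s x\<close>, so \<open>p\<close> is the radial projection.\<close>
  define m where "m x = min (x a) (min (x b) (x c))" for x :: "nat \<Rightarrow> real"
  define V where "V = {a,b,c}"
  define s where "s x = 1 - 3 * m x" for x
  define p where "p x = (\<lambda>i. if i \<in> V then (x i - m x) / s x else 0)" for x :: "nat \<Rightarrow> real"
  have gD: "x \<in> geom ?D \<longleftrightarrow> (\<forall>i. 0 \<le> x i) \<and> (\<forall>i. i \<notin> V \<longrightarrow> x i = 0) \<and> x a + x b + x c = 1" for x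
  proof
    assume x: "x \<in> geom ?D"
    have "{v. x v \<noteq> 0} \<subseteq> V" using geom_support[OF x] by (auto simp: V_def)
    moreover then have "sum x V = 1" by (intro geom_sum[OF x]) (auto simp: V_def)
    ultimately show "(\<forall>i. 0 \<le> x i) \<and> (\<forall>i. i \<notin> V \<longrightarrow> x i = 0) \<and> x a + x b + x c = 1"
      using ne geom_nonneg[OF x] by (auto simp: V_def)
  next
    assume "(\<forall>i. 0 \<le> x i) \<and> (\<forall>i. i \<notin> V \<longrightarrow> x i = 0) \<and> x a + x b + x c = 1"
    then show "x \<in> geom ?D" using ne by (intro geomI[OF cD, of V]) (auto simp: V_def)
  qed
  have gS: "x \<in> geom ?S \<longleftrightarrow> x \<in> geom ?D \<and> m x = 0" for x
  proof
    assume x: "x \<in> geom ?S"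
    have "x \<in> geom ?D" using x geom_mono[of ?S ?D] by blast
    moreover have "{v. x v \<noteq> 0} \<noteq> V" using geom_support[OF x] by (auto simp: V_def)
    ultimately show "x \<in> geom ?D \<and> m x = 0" using gD[of x] by (auto simp: V_def m_def min_def order.antisym)
  next
    assume x: "x \<in> geom ?D \<and> m x = 0"
    then have "x a = 0 \<or> x b = 0 \<or> x c = 0" by (auto simp: m_def min_def split: if_splits)
    then have "{v. x v \<noteq> 0} \<noteq> {a,b,c}" by auto
    then show "x \<in> geom ?S" using x by (auto simp: geom_def)
  qed
  show ?thesis
  proof (rule disc_extending_radial[where s = s and p = p and ?x0.0 = "\<lambda>i. if i \<in> V then 1/3 else 0"])
    show "simplicial_cpx ?D" "finite ?D" "triangulates_sphere n ?S" using cD S by auto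
    show "subcomplex ?S ?D" using cS by (auto simp: subcomplex_def)
    have cm: "continuous_on A m" for A
      unfolding m_def by (intro continuous_intros continuous_on_coord)
    then show cs: "continuous_on (geom ?D) s" unfolding s_def by (intro continuous_intros)
    show "continuous_on {x \<in> geom ?D. s x \<noteq> 0} p"
      unfolding p_def
    proof (rule continuous_on_coordinatewise_then_product)
      fix i show "continuous_on {x \<in> geom ?D. s x \<noteq> 0} (\<lambda>x. if i \<in> V then (x i - m x) / s x else 0)"
        by (cases "i \<in> V") (auto intro!: continuous_intros continuous_on_coord cm continuous_on_subset[OF cs])
    qed
    show "(\<lambda>i. if i \<in> V then 1/3 else 0) \<in> geom ?D" unfolding gD by (auto simp: V_def)
    fix x assume x: "x \<in> geom ?D"
    note X = x[unfolded gD]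
    show sx: "0 \<le> s x \<and> s x \<le> 1" using X by (auto simp: s_def m_def)
    show "p x \<in> geom ?S" if "s x \<noteq> 0"
    proof -
      have "(x a - m x) / s x + (x b - m x) / s x + (x c - m x) / s x = 1"
      proof -
        have "(x a - m x) / s x + (x b - m x) / s x + (x c - m x) / s x = (x a + x b + x c - 3 * m x) / s x"
          by (simp add: add_divide_distrib diff_divide_distrib)
        then show ?thesis using X that by (simp add: s_def)
      qed
      then have sum1: "p x a + p x b + p x c = 1" by (simp add: p_def V_def)
      have nn: "0 \<le> p x i" for i using sx by (auto simp: p_def V_def m_def)
      have "x a = m x \<or> x b = m x \<or> x c = m x" by (auto simp: m_def)
      then have "p x a = 0 \<or> p x b = 0 \<or> p x c = 0" by (auto simp: p_def)
      then have "m (p x) = 0" using nn[of a] nn[of b] nn[of c] by (auto simp: m_def)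
      moreover have "p x i = 0" if "i \<notin> V" for i using that by (simp add: p_def)
      ultimately show ?thesis using sum1 nn unfolding gS gD by blast
    qed
    show "s x = 0 \<longleftrightarrow> x = (\<lambda>i. if i \<in> V then 1/3 else 0)"
    proof
      assume s0: "s x = 0"
      then have "m x = 1/3" by (simp add: s_def)
      moreover have "m x \<le> x a" "m x \<le> x b" "m x \<le> x c" by (auto simp: m_def)
      ultimately have "x a = 1/3" "x b = 1/3" "x c = 1/3" using X by linarith+
      then show "x = (\<lambda>i. if i \<in> V then 1/3 else 0)" using X by (auto simp: V_def)
    qed (auto simp: s_def m_def V_def)
    fix y assume y: "y \<in> geom ?D" and sy: "s x \<noteq> 0" "s x = s y" "p x = p y"
    show "x = y"
    proof
      fix i
      have "m x = m y" using sy by (simp add: s_def)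
      then show "x i = y i" using fun_cong[OF sy(3), of i] sy X y[unfolded gD]
        by (cases "i \<in> V") (auto simp: p_def)
    qed
  next
    fix d y assume d: "(0::real) < d" "d \<le> 1" and y: "y \<in> geom ?S"
    \<comment> \<open>The convex combination of \<open>y\<close> and the barycentre with weights
      \<open>d\<close> and \<open>1 - d\<close>; its least coordinate is \<open>(1 - d) / 3\<close>
      because that of \<open>y\<close> is 0.\<close>
    define x where "x i = (if i \<in> V then d * y i + (1 - d) / 3 else 0)" for i
    have Y: "y \<in> geom ?D" "m y = 0" using y gS by auto
    have xm: "m x = (1 - d) / 3" using Y(2) d Y(1)[unfolded gD]
      by (auto simp: m_def x_def V_def min_def mult_le_0_iff split: if_splits)
    have "x a + x b + x c = d * (y a + y b + y c) + (1 - d)"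
      by (simp add: x_def V_def field_simps)
    then have "x \<in> geom ?D" using d Y(1) unfolding gD by (auto simp: x_def)
    moreover have "s x = d" using xm by (simp add: s_def)
    moreover have "p x = y"
    proof
      fix i
      have "x i - m x = d * y i" if "i \<in> V" using xm that by (simp add: x_def)
      then show "p x i = y i" using \<open>s x = d\<close> d Y(1)[unfolded gD] by (auto simp: p_def)
    qed
    ultimately show "\<exists>x\<in>geom ?D. s x = d \<and> p x = y" by blast
  next
    fix y assume "y \<in> geom ?S"
    then show "s y = 1 \<and> p y = y" using gS gD by (auto simp: s_def p_def)
  qed
qed

section \<open>Attaching a fan to a disc\<close>

definition wedge_cpx :: "'a \<Rightarrow> 'a \<Rightarrow> 'a \<Rightarrow> 'a set set" where
  "wedge_cpx a w b = {{a}, {w}, {b}, {a, w}, {w, b}}"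

text \<open>Parametrizes the path \<open>a\<close>, \<open>w\<close>, \<open>b\<close> by
  \<open>s\<close> from -1 to 1, with \<open>w\<close> at 0. The inverse is
  \<open>x b - x a\<close>, which is what the function \<open>U\<close> of the fan becomes on this
  path.\<close>

definition arc_pt :: "'a \<Rightarrow> 'a \<Rightarrow> 'a \<Rightarrow> real \<Rightarrow> 'a \<Rightarrow> real" where
  "arc_pt a w b s = (\<lambda>i. if i = a then max 0 (- s) else if i = b then max 0 s
     else if i = w then 1 - \<bar>s\<bar> else 0)"

lemma simplicial_wedge: "simplicial_cpx (wedge_cpx a w b)"
  unfolding simplicial_cpx_def
proof (intro ballI conjI allI impI)
  fix \<sigma> assume s: "\<sigma> \<in> wedge_cpx a w b"
  show "finite \<sigma>" "\<sigma> \<noteq> {}" using s by (auto simp: wedge_cpx_def)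
  fix \<tau> assume "\<tau> \<subseteq> \<sigma> \<and> \<tau> \<noteq> {}"
  then have "\<tau> \<in> Pow \<sigma> - {{}}" by simp
  then show "\<tau> \<in> wedge_cpx a w b" using s by (auto simp: wedge_cpx_def Pow_insert)
qed

lemma arc_pt_in_wedge:
  assumes "distinct [a, w, b]" "\<bar>s\<bar> \<le> 1"
  shows "arc_pt a w b s \<in> geom (wedge_cpx a w b)"
proof (cases "s \<le> 0")
  case True
  then show ?thesis using assms
    by (intro geomI[OF simplicial_wedge, of "{a, w}"]) (auto simp: arc_pt_def wedge_cpx_def)
next
  case False
  then show ?thesis using assms
    by (intro geomI[OF simplicial_wedge, of "{w, b}"]) (auto simp: arc_pt_def wedge_cpx_def)
qed

text \<open>The support lies in one of the two edges, so one of \<open>x a\<close> and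
  \<open>x b\<close> vanishes and their difference determines the point.\<close>

lemma geom_wedgeE:
  assumes "x \<in> geom (wedge_cpx a w b)" "distinct [a, w, b]"
  shows "\<bar>x b - x a\<bar> \<le> 1" "arc_pt a w b (x b - x a) = x" "\<And>i. i \<notin> {a, w, b} \<Longrightarrow> x i = 0"
proof -
  have nn: "0 \<le> x i" for i using geom_nonneg[OF assms(1)] .
  have "{v. x v \<noteq> 0} \<in> wedge_cpx a w b" using geom_support[OF assms(1)] .
  then obtain \<tau> where \<tau>: "\<tau> = {a, w} \<or> \<tau> = {w, b}" "{v. x v \<noteq> 0} \<subseteq> \<tau>"
    unfolding wedge_cpx_def by blast
  have s: "sum x \<tau> = 1" using \<tau> by (intro geom_sum[OF assms(1)]) auto
  have z: "x v = 0" if "v \<notin> \<tau>" for v using \<tau>(2) that by blast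
  consider "x b = 0" "x a + x w = 1" | "x a = 0" "x w + x b = 1"
    using \<tau>(1) s z[of a] z[of b] assms(2) by force
  note cases = this
  show z': "x i = 0" if "i \<notin> {a, w, b}" for i using z[of i] \<tau>(1) that by blast
  show "\<bar>x b - x a\<bar> \<le> 1" using nn[of a] nn[of b] nn[of w] by (cases rule: cases) linarith+
  show "arc_pt a w b (x b - x a) = x"
  proof
    fix i
    show "arc_pt a w b (x b - x a) i = x i"
      using nn[of a] nn[of b] nn[of w] z'[of i] assms(2)
      by (cases rule: cases; cases "i = a"; cases "i = b"; cases "i = w") (simp_all add: arc_pt_def)
  qed
qed

lemma continuous_on_arc_pt:
  "continuous_on A f \<Longrightarrow> continuous_on A (\<lambda>x. arc_pt a w b (f x))"
  unfolding arc_pt_def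
proof (rule continuous_on_coordinatewise_then_product)
  fix i assume f: "continuous_on A f"
  show "continuous_on A (\<lambda>x. if i = a then max 0 (- f x) else if i = b then max 0 (f x)
     else if i = w then 1 - \<bar>f x\<bar> else 0)"
    by (cases "i = a"; cases "i = b"; cases "i = w") (auto intro!: continuous_intros f)
qed

text \<open>
  \<open>L\<close> is a subdivided arc from \<open>a\<close> to \<open>b\<close>, parametrized over \<open>[-1, 1]\<close> by the linear function \<open>U\<close>.
  On the cone over \<open>L\<close> with apex \<open>w\<close>, the pair of \<open>U\<close> and the barycentric coordinate of \<open>w\<close> are
  coordinates in the triangle \<open>0 \<le> d \<le> 1 - \<bar>s\<bar>\<close>, whose upper sides correspond to
  \<open>wedge_cpx a w b\<close>.
\<close>

locale fan =
  fixes a w b :: nat and L :: "nat set set" and V :: "nat set" and c :: "nat \<Rightarrow> real"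
    and U :: "(nat \<Rightarrow> real) \<Rightarrow> real"
  assumes dist: "distinct [a, w, b]"
    and L: "simplicial_cpx L" "finite L" "w \<notin> vertex_set L" "{a} \<in> L" "{b} \<in> L"
    and V: "finite V" "w \<notin> V" "a \<in> V" "b \<in> V"
    and U: "U = (\<lambda>x. \<Sum>v\<in>V. c v * x v)" and c: "c a = -1" "c b = 1"
    and bij: "inj_on U (geom L)" "U ` geom L = {-1..1}"
begin

abbreviation "C \<equiv> cone_cpx w L"

lemma C: "simplicial_cpx C" "finite C" "geom L \<subseteq> geom C"
  using L simplicial_cone_cpx finite_cone_cpx by (auto simp: cone_cpx_def intro: geom_mono[THEN subsetD])

lemma continuous_U: "continuous_on A U"
  unfolding U by (intro continuous_intros continuous_on_coord)

lemma wedge_sub_C: "wedge_cpx a w b \<subseteq> C"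
  using L by (auto simp: wedge_cpx_def cone_cpx_def)

lemma U_wedge:
  assumes "\<And>i. i \<notin> {a, w, b} \<Longrightarrow> x i = 0"
  shows "U x = x b - x a"
proof -
  have "U x = (\<Sum>v\<in>{a, b}. c v * x v)"
    unfolding U using V assms by (intro sum.mono_neutral_right) auto
  then show ?thesis using c dist by auto
qed

lemma U_arc_pt: "U (arc_pt a w b s) = s"
  by (subst U_wedge) (use dist in \<open>auto simp: arc_pt_def\<close>)

text \<open>\<open>U\<close> is linear and has no term at \<open>w\<close>, so along the segment to
  the apex it shrinks by the factor \<open>1 - x w\<close>.\<close>

lemma U_cone:
  assumes "x \<in> geom C" "x w \<noteq> 1"
  obtains y where "y \<in> geom L" "U x = (1 - x w) * U y" "x = (\<lambda>i. if i = w then x w else (1 - x w) * y i)"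
proof
  define y where "y = (\<lambda>i. if i = w then 0 else x i / (1 - x w))"
  show "y \<in> geom L" using cone_base(3)[OF L(1,3) assms] by (simp add: y_def)
  show "x = (\<lambda>i. if i = w then x w else (1 - x w) * y i)" using assms(2) by (auto simp: y_def)
  have "c v * x v = (1 - x w) * (c v * y v)" if "v \<in> V" for v using that assms(2) V(2) by (auto simp: y_def)
  then show "U x = (1 - x w) * U y" unfolding U sum_distrib_left by (intro sum.cong) auto
qed

lemma U_apex: "x \<in> geom C \<Longrightarrow> x w = 1 \<Longrightarrow> U x = 0"
  using cone_base(4)[OF L(1,3)] V(2) unfolding U by (intro sum.neutral) (metis mult_zero_right)

text \<open>The slice of the cone at height \<open>x w\<close> is a copy of the arc shrunk by
  \<open>1 - x w\<close>, so \<open>|U x|\<close> is at most \<open>1 - x w\<close>. This places the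
  cone in the triangle; the next two lemmas give a bijection.\<close>

lemma U_bound:
  assumes "x \<in> geom C"
  shows "0 \<le> x w" "x w \<le> 1 - \<bar>U x\<bar>"
proof -
  show "0 \<le> x w" using cone_base[OF L(1,3) assms] by auto
  show "x w \<le> 1 - \<bar>U x\<bar>"
  proof (cases "x w = 1")
    case False
    obtain y where y: "y \<in> geom L" "U x = (1 - x w) * U y" using U_cone[OF assms False] by blast
    have "U y \<in> {-1..1}" using y(1) bij(2) by blast
    then have "\<bar>U y\<bar> \<le> 1" by auto
    moreover have "x w \<le> 1" using cone_base[OF L(1,3) assms] by auto
    ultimately have "\<bar>U x\<bar> \<le> 1 - x w" by (simp add: y(2) abs_mult mult_left_le)
    then show ?thesis by simp
  qed (use U_apex assms in simp)
qed

lemma U_inj: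
  assumes "x \<in> geom C" "y \<in> geom C" "U x = U y" "x w = y w"
  shows "x = y"
proof (cases "x w = 1")
  case True
  then show ?thesis using cone_base(4)[OF L(1,3)] assms by metis
next
  case False
  obtain x' where x': "x' \<in> geom L" "U x = (1 - x w) * U x'" "x = (\<lambda>i. if i = w then x w else (1 - x w) * x' i)"
    using U_cone[OF assms(1) False] .
  obtain y' where y': "y' \<in> geom L" "U y = (1 - y w) * U y'" "y = (\<lambda>i. if i = w then y w else (1 - y w) * y' i)"
    using U_cone[OF assms(2)] False assms(4) by metis
  have "U x' = U y'" using x'(2) y'(2) assms(3,4) False by simp
  then have "x' = y'" using bij(1) x'(1) y'(1) by (meson inj_onD)
  then show ?thesis using x'(3) y'(3) assms(4) by metis
qed

lemma U_surj:
  assumes "0 \<le> d" "d \<le> 1 - \<bar>s\<bar>"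
  shows "\<exists>x\<in>geom C. U x = s \<and> x w = d"
proof (cases "d = 1")
  case True
  then have "s = 0" using assms by simp
  moreover have "arc_pt a w b 0 \<in> geom C"
    using arc_pt_in_wedge[OF dist, of 0] geom_mono[OF wedge_sub_C] by auto
  ultimately show ?thesis using U_arc_pt[of 0] True dist
    by (intro bexI[of _ "arc_pt a w b 0"]) (auto simp: arc_pt_def)
next
  case False
  then have d: "d < 1" using assms by simp
  \<comment> \<open>The slice at height \<open>d\<close> was shrunk by \<open>1 - d\<close>, so the
    base point below coordinate \<open>s\<close> has coordinate \<open>s / (1 - d)\<close>.\<close>
  have "s / (1 - d) \<in> {-1..1}" using assms d by (simp add: field_simps) linarith
  then obtain y where y: "y \<in> geom L" "U y = s / (1 - d)" using bij(2) by (metis imageE)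
  define x where "x = (\<lambda>i. if i = w then 1 - (1 - d) else (1 - d) * y i)"
  have "x \<in> geom C" unfolding x_def by (rule cone_point[OF L(1,3) y(1)]) (use assms d in auto)
  moreover have "U x = (1 - d) * U y" unfolding U sum_distrib_left
    using V(2) by (intro sum.cong) (auto simp: x_def)
  ultimately show ?thesis using y(2) d by (intro bexI[of _ x]) (auto simp: x_def)
qed

text \<open>
  In polar coordinates around the image of \<open>D'\<close>, the cone becomes a lens attached along the boundary
  arc \<open>wedge_cpx a w b\<close>: the ray through \<open>y\<close> is prolonged from length \<open>1\<close> to \<open>1 + y w\<close>. Dividing
  by this length gives the map \<open>H\<close> onto the unit disc.
\<close>

lemma disc_extending_fan:
  assumes D': "disc_extending 1 (T \<union> wedge_cpx a w b) D'"
    and T: "simplicial_cpx T" "w \<notin> vertex_set T"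
    and int: "D' \<inter> C = wedge_cpx a w b"
  shows "disc_extending 1 (T \<union> L) (D' \<union> C)"
proof -
  let ?S = "T \<union> wedge_cpx a w b"
  let ?arc = "arc_pt a w b"
  obtain h where h: "simplicial_cpx D'" "finite D'" "subcomplex ?S D'" "continuous_on (geom D') h"
    "inj_on h (geom D')" "h ` geom D' = cball (0::complex) 1" "h ` geom ?S = sphere 0 1"
    using disc_extending_1E[OF D'] .
  obtain k where k: "homeomorphism (geom D') (cball 0 1) h k"
    using homeomorphism_compact[OF compact_geom[OF h(1,2)] h(4,6,5)] by blast
  have kh: "\<And>x. x \<in> geom D' \<Longrightarrow> k (h x) = x" "\<And>z. z \<in> cball 0 1 \<Longrightarrow> h (k z) = z"
    "\<And>z. z \<in> cball 0 1 \<Longrightarrow> k z \<in> geom D'" "continuous_on (cball 0 1) k"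
    using k by (auto simp: homeomorphism_def)
  have SD: "geom ?S \<subseteq> geom D'" using h(3) by (simp add: subcomplex_def geom_mono)
  have kS: "k z \<in> geom ?S" if "z \<in> sphere 0 1" for z
  proof -
    obtain y where "y \<in> geom ?S" "z = h y" using \<open>z \<in> sphere 0 1\<close> h(7) by (metis imageE)
    then show ?thesis using kh(1) SD by auto
  qed
  have hS: "norm (h y) = 1" if "y \<in> geom ?S" for y using that h(7) by auto
  have yw: "0 \<le> y w" "y w \<le> 1" if "y \<in> geom ?S" for y
  proof -
    show "0 \<le> y w" using geom_nonneg[OF that] .
    consider "y \<in> geom T" | "y \<in> geom (wedge_cpx a w b)" using \<open>y \<in> geom ?S\<close> unfolding geom_Un by blast
    then show "y w \<le> 1"
    proof cases
      case 1 then show ?thesis using geom_vertex_zero[OF T(1) 1 T(2)] by simp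
    next
      case 2
      then have "y \<in> geom C" using geom_mono[OF wedge_sub_C] by blast
      then show ?thesis using U_bound[of y] by linarith
    qed
  qed
  have arcS: "?arc s \<in> geom ?S" "?arc s w = 1 - \<bar>s\<bar>" if "\<bar>s\<bar> \<le> 1" for s
    using arc_pt_in_wedge[OF dist that] dist by (auto simp: arc_pt_def geom_Un)
  have wedge: "?arc (U x) = x" "\<bar>U x\<bar> \<le> 1" "x w = 1 - \<bar>U x\<bar>" if "x \<in> geom (wedge_cpx a w b)" for x
  proof -
    have Ux: "U x = x b - x a" using geom_wedgeE(3)[OF that dist] by (rule U_wedge)
    show 1: "?arc (U x) = x" "\<bar>U x\<bar> \<le> 1" unfolding Ux using geom_wedgeE(1,2)[OF that dist] by blast+
    show "x w = 1 - \<bar>U x\<bar>" using arcS(2)[OF 1(2)] 1(1) by simp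
  qed
  \<comment> \<open>The prolonged length of the ray through \<open>z\<close>. It is 1 on rays that
    miss the wedge, since \<open>w\<close> is not a vertex of \<open>T\<close>.\<close>
  define g where "g z = 1 + k (sgn z) w" for z
  have sgn1: "sgn z \<in> sphere 0 1" if "z \<noteq> 0" for z :: complex using that by (simp add: norm_sgn)
  have g1: "1 \<le> g z" if "z \<noteq> 0" for z using yw(1)[OF kS[OF sgn1[OF that]]] by (simp add: g_def)
  define R where "R z = norm z *\<^sub>R ((1 / g z) *\<^sub>R sgn z)" for z :: complex
  have contR: "continuous_on (cball 0 1) R"
    unfolding R_def
  proof (rule continuous_on_scaleR_bounded)
    have cs: "continuous_on {z \<in> cball 0 1. norm z \<noteq> 0} (sgn :: complex \<Rightarrow> complex)"
      unfolding sgn_div_norm by (intro continuous_intros) auto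
    have "continuous_on {z \<in> cball 0 1. norm z \<noteq> 0} (\<lambda>z. k (sgn z))"
      by (rule continuous_on_compose2[OF kh(4) cs]) (auto simp: norm_sgn)
    then have "continuous_on {z \<in> cball 0 1. norm z \<noteq> 0} (\<lambda>z. k (sgn z) w)"
      by (rule continuous_on_product_then_coordinatewise)
    then have "continuous_on {z \<in> cball 0 1. norm z \<noteq> 0} g"
      unfolding g_def by (intro continuous_intros)
    moreover have "g z \<noteq> 0" if "z \<in> {z \<in> cball 0 1. norm z \<noteq> 0}" for z using that g1[of z] by auto
    ultimately show "continuous_on {z \<in> cball 0 1. norm z \<noteq> 0} (\<lambda>z. (1 / g z) *\<^sub>R sgn z)"
      using cs by (intro continuous_intros) auto
    fix z :: complex assume "norm z \<noteq> 0"
    then show "norm ((1 / g z) *\<^sub>R sgn z) \<le> 1" using g1[of z] by (auto simp: norm_sgn)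
  qed (intro continuous_intros)
  \<comment> \<open>In the triangle coordinates \<open>s = U x\<close> and \<open>d = x w\<close>,
    the ray through \<open>?arc s\<close> has prolonged length \<open>2 - |s|\<close>. The radius is
    affine in \<open>d\<close>: it is 1 on the outer arc \<open>d = 0\<close> and
    \<open>1 / (2 - |s|)\<close> on the wedge \<open>d = 1 - |s|\<close>, which is the radius that
    \<open>R\<close> gives there.\<close>
  define Q where "Q x = (1 - x w / (2 - \<bar>U x\<bar>)) *\<^sub>R h (?arc (U x))" for x
  define H where "H x = (if x \<in> geom D' then R (h x) else Q x)" for x
  \<comment> \<open>Uniqueness of polar coordinates, with directions named by boundary points: on
    the loop \<open>h\<close> is injective and of norm 1.\<close>
  have rep_unique: "r = r' \<and> y = y'"
    if "r *\<^sub>R h y = r' *\<^sub>R h y'" "0 < r" "0 < r'" "y \<in> geom ?S" "y' \<in> geom ?S" for r r' y y'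
  proof -
    have "norm (r *\<^sub>R h y) = norm (r' *\<^sub>R h y')" using that(1) by simp
    then have "r = r'" using hS[OF that(4)] hS[OF that(5)] that(2,3) by simp
    moreover then have "h y = h y'" using that by simp
    ultimately show ?thesis using h(5) SD that by (meson inj_onD subsetD)
  qed
  have Rrep: "R (h x) = (norm (h x) / (1 + y w)) *\<^sub>R h y" "h x = norm (h x) *\<^sub>R h y" "y \<in> geom ?S"
    if "h x \<noteq> 0" "y = k (sgn (h x))" for x y
  proof -
    have s: "sgn (h x) \<in> sphere 0 1" using sgn1[OF that(1)] .
    then have "h y = sgn (h x)" using kh(2) that(2) by auto
    then show "R (h x) = (norm (h x) / (1 + y w)) *\<^sub>R h y" "h x = norm (h x) *\<^sub>R h y"
      using that by (auto simp: R_def g_def sgn_div_norm)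
    show "y \<in> geom ?S" using kS[OF s] that by simp
  qed
  have RS: "R (h y) = (1 / (1 + y w)) *\<^sub>R h y" if y: "y \<in> geom ?S" for y
  proof -
    have "sgn (h y) = h y" using hS[OF y] by (simp add: sgn_div_norm)
    moreover have "k (h y) = y" using kh(1) y SD by blast
    ultimately show ?thesis using hS[OF y] Rrep(1)[of y y] by fastforce
  qed
  have Qf: "1 / (2 - \<bar>U x\<bar>) \<le> 1 - x w / (2 - \<bar>U x\<bar>)" "0 < 1 / (2 - \<bar>U x\<bar>)"
    "1 - x w / (2 - \<bar>U x\<bar>) \<le> 1" "\<bar>U x\<bar> \<le> 1" if "x \<in> geom C" for x
    using U_bound[OF that] by (auto simp: field_simps)
  have agree: "R (h x) = Q x" if "x \<in> geom D'" "x \<in> geom C" for x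
  proof -
    have x: "x \<in> geom (wedge_cpx a w b)" using that int geom_Int by (metis IntI)
    have "R (h x) = (1 / (1 + x w)) *\<^sub>R h x" using RS[of x] x unfolding geom_Un by blast
    moreover have "1 - (1 - \<bar>U x\<bar>) / (2 - \<bar>U x\<bar>) = 1 / (2 - \<bar>U x\<bar>)"
      using wedge(2)[OF x] by (simp add: field_simps)
    ultimately show ?thesis unfolding Q_def wedge(1)[OF x] using wedge(3)[OF x] by simp
  qed
  have HC: "H x = Q x" if "x \<in> geom C" for x using agree that by (simp add: H_def)
  have HD: "H x = R (h x)" if "x \<in> geom D'" for x using that by (simp add: H_def)
  have "continuous_on (geom C) (\<lambda>x. h (?arc (U x)))"
  proof (rule continuous_on_compose2[OF h(4)])
    show "continuous_on (geom C) (\<lambda>x. ?arc (U x))" by (intro continuous_on_arc_pt continuous_U)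
    show "(\<lambda>x. ?arc (U x)) ` geom C \<subseteq> geom D'" using arcS(1) Qf(4) SD by blast
  qed
  moreover have "2 - \<bar>U x\<bar> \<noteq> 0" if "x \<in> geom C" for x using Qf(4)[OF that] by auto
  ultimately have contQ: "continuous_on (geom C) Q"
    unfolding Q_def by (intro continuous_intros continuous_on_coord continuous_U) auto
  have contH: "continuous_on (geom (D' \<union> C)) H"
    unfolding geom_Un H_def
  proof (rule continuous_on_cases)
    show "closed (geom D')" "closed (geom C)" using compact_geom h C compact_imp_closed by blast+
    show "continuous_on (geom D') (\<lambda>x. R (h x))"
      by (rule continuous_on_compose2[OF contR h(4)]) (use h(6) in auto)
    show "continuous_on (geom C) Q" by (rule contQ)
    show "\<forall>x. x \<in> geom D' \<and> x \<notin> geom D' \<or> x \<in> geom C \<and> x \<in> geom D' \<longrightarrow> R (h x) = Q x"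
      using agree by blast
  qed
  \<comment> \<open>On the ray of \<open>?arc (U x')\<close> the map \<open>R\<close> stays within
    radius \<open>1 / (2 - |U x'|)\<close>, and \<open>Q\<close> never goes below it. Equal values
    force equality in both bounds, so both points lie on the wedge.\<close>
  have injDC: "x = x'" if x: "x \<in> geom D'" and x': "x' \<in> geom C" and e: "R (h x) = Q x'" for x x'
  proof -
    let ?y = "?arc (U x')" and ?f = "1 - x' w / (2 - \<bar>U x'\<bar>)"
    have y: "?y \<in> geom ?S" "?y w = 1 - \<bar>U x'\<bar>" using arcS Qf(4)[OF x'] by auto
    have f: "0 < ?f" using Qf(1,2)[OF x'] by linarith
    have "Q x' \<noteq> 0" using f hS[OF y(1)] by (auto simp: Q_def)
    then have nz: "h x \<noteq> 0" using e by (auto simp: R_def)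
    define y where "y = k (sgn (h x))"
    note rr = Rrep[OF nz y_def]
    have "norm (h x) / (1 + y w) = ?f \<and> y = ?y"
      by (rule rep_unique) (use rr y f e nz yw[OF rr(3)] in \<open>auto simp: Q_def\<close>)
    then have eq: "norm (h x) / (2 - \<bar>U x'\<bar>) = ?f" "y = ?y" using y(2) by auto
    then have "norm (h x) = 2 - \<bar>U x'\<bar> - x' w" using Qf(4)[OF x'] by (simp add: field_simps)
    moreover have "norm (h x) \<le> 1" using x h(6) by auto
    ultimately have n1: "norm (h x) = 1" "x' w = 1 - \<bar>U x'\<bar>" using U_bound[OF x'] by auto
    have "h x = h ?y" using rr(2) n1 eq(2) by simp
    then have "x = ?y" using h(5) x y(1) SD by (meson inj_onD subsetD)
    moreover have "?y = x'"
    proof (rule U_inj)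
      show "?y \<in> geom C" using arc_pt_in_wedge[OF dist Qf(4)[OF x']] geom_mono[OF wedge_sub_C] by blast
    qed (use x' U_arc_pt y(2) n1 in auto)
    ultimately show ?thesis by simp
  qed
  have injH: "inj_on H (geom (D' \<union> C))"
  proof (rule inj_onI)
    fix x x' assume xx: "x \<in> geom (D' \<union> C)" "x' \<in> geom (D' \<union> C)" "H x = H x'"
    consider "x \<in> geom D'" "x' \<in> geom D'" | "x \<in> geom C" "x' \<in> geom C"
      | "x \<in> geom D'" "x' \<in> geom C" | "x' \<in> geom D'" "x \<in> geom C"
      using xx by (auto simp: geom_Un)
    then show "x = x'"
    proof cases
      case 1
      then have e: "R (h x) = R (h x')" using xx HD by simp
      have R0: "R z = 0 \<longleftrightarrow> z = 0" for z
        using g1[of z] by (cases "z = 0") (auto simp: R_def sgn_zero_iff)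
      show ?thesis
      proof (cases "h x = 0")
        case True
        then have "h x' = 0" using e R0 by metis
        then show ?thesis using True 1 h(5) by (metis inj_onD)
      next
        case False
        then have nz: "h x' \<noteq> 0" using e R0 by metis
        define y y' where "y = k (sgn (h x))" and "y' = k (sgn (h x'))"
        note r = Rrep[OF False y_def(1)] and r' = Rrep[OF nz y'_def]
        have "norm (h x) / (1 + y w) = norm (h x') / (1 + y' w) \<and> y = y'"
          by (rule rep_unique) (use r r' e False nz yw[OF r(3)] yw[OF r'(3)] in auto)
        then have "norm (h x) = norm (h x')" "y = y'" using yw[OF r(3)] by auto
        then have "h x = h x'" using r(2) r'(2) by metis
        then show ?thesis using 1 h(5) by (metis inj_onD)
      qed
    next
      case 2
      then have e: "Q x = Q x'" using xx HC by simp
      have Qpos: "0 < 1 - x w / (2 - \<bar>U x\<bar>)" "0 < 1 - x' w / (2 - \<bar>U x'\<bar>)"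
        using Qf(1,2)[OF 2(1)] Qf(1,2)[OF 2(2)] by linarith+
      have "(1 - x w / (2 - \<bar>U x\<bar>)) = (1 - x' w / (2 - \<bar>U x'\<bar>)) \<and> ?arc (U x) = ?arc (U x')"
        by (rule rep_unique) (use e arcS(1) Qf(4) Qpos 2 in \<open>auto simp: Q_def\<close>)
      then have "U x = U x'" "x w / (2 - \<bar>U x\<bar>) = x' w / (2 - \<bar>U x'\<bar>)" using U_arc_pt by (metis, simp)
      then show ?thesis using 2 Qf(4)[OF 2(1)] by (intro U_inj) auto
    next
      case 3
      then show ?thesis using injDC xx HC HD by simp
    next
      case 4
      then show ?thesis using injDC[OF 4] xx HC HD by simp
    qed
  qed
  have imgD: "H ` geom D' \<subseteq> cball 0 1"
  proof (clarify)
    fix x assume x: "x \<in> geom D'"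
    have "norm (R (h x)) \<le> norm (h x)"
      using g1[of "h x"] by (cases "h x = 0") (auto simp: R_def norm_sgn field_simps mult_left_le)
    moreover have "norm (h x) \<le> 1" using x h(6) by auto
    ultimately show "H x \<in> cball 0 1" using HD[OF x] by simp
  qed
  have imgC: "H ` geom C \<subseteq> cball 0 1"
  proof (clarify)
    fix x assume x: "x \<in> geom C"
    have "norm (Q x) = \<bar>1 - x w / (2 - \<bar>U x\<bar>)\<bar>" using hS[OF arcS(1)[OF Qf(4)[OF x]]] by (simp add: Q_def)
    also have "\<dots> \<le> 1" using Qf[OF x] by linarith
    finally show "H x \<in> cball 0 1" using HC[OF x] by simp
  qed
  have onto: "cball 0 1 \<subseteq> H ` geom (D' \<union> C)"
  proof
    fix z :: complex assume z: "z \<in> cball 0 1"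
    show "z \<in> H ` geom (D' \<union> C)"
    proof (cases "z = 0")
      case True
      have "H (k 0) = 0" using HD kh(2,3)[of 0] by (simp add: R_def)
      then show ?thesis using True kh(3)[of 0] unfolding geom_Un by force
    next
      case False
      define y where "y = k (sgn z)"
      have s: "sgn z \<in> sphere 0 1" using sgn1[OF False] .
      have y: "y \<in> geom ?S" "h y = sgn z" using kS[OF s] kh(2) s by (auto simp: y_def)
      have zy: "z = norm z *\<^sub>R h y" using y(2) False by (simp add: sgn_div_norm)
      \<comment> \<open>\<open>R\<close> compresses the ray through \<open>y\<close> by
        \<open>1 + y w\<close>. A point whose expanded norm is still at most 1 comes from
        \<open>D'\<close>, any other from the fan.\<close>
      show ?thesis
      proof (cases "norm z * (1 + y w) \<le> 1")
        case True
        define x where "x = k ((norm z * (1 + y w)) *\<^sub>R sgn z)"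
        have m: "(norm z * (1 + y w)) *\<^sub>R sgn z \<in> cball 0 1"
          using True yw[OF y(1)] by (simp add: norm_sgn abs_mult)
        have x: "x \<in> geom D'" "h x = (norm z * (1 + y w)) *\<^sub>R sgn z" using kh m by (auto simp: x_def)
        have pos: "norm z * (1 + y w) > 0" using False yw[OF y(1)] by simp
        then have nz: "h x \<noteq> 0" using x(2) False by (auto simp: sgn_zero_iff)
        have sx: "sgn (h x) = sgn z" using pos by (simp only: x(2) sgn_scaleR sgn_pos scaleR_one sgn_sgn)
        have nx: "norm (h x) = norm z * (1 + y w)" using pos False yw[OF y(1)] by (simp add: x(2) norm_sgn abs_mult)
        have "R (h x) = (norm (h x) / (1 + y w)) *\<^sub>R h y" by (rule Rrep(1)[OF nz]) (simp add: sx y_def)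
        also have "\<dots> = z" using nx yw[OF y(1)] zy by simp
        finally have "H x = z" using HD x(1) by simp
        then show ?thesis using x(1) unfolding geom_Un by blast
      next
        case big: False
        \<comment> \<open>Only rays across the wedge are prolonged, so \<open>y\<close> cannot lie
          in \<open>T\<close>.\<close>
        have "norm z \<le> 1" using z by simp
        then have "y w \<noteq> 0" using big by auto
        then have "y \<notin> geom T" using geom_vertex_zero[OF T(1) _ T(2)] by blast
        then have yP: "y \<in> geom (wedge_cpx a w b)" using y(1) unfolding geom_Un by blast
        note W = wedge[OF yP]
        \<comment> \<open>The height at which \<open>Q\<close> has radius \<open>norm z\<close> on
          this ray.\<close>
        define d where "d = (1 - norm z) * (2 - \<bar>U y\<bar>)"
        have "0 \<le> d" using W(2) \<open>norm z \<le> 1\<close> by (simp add: d_def)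
        moreover have "d \<le> 1 - \<bar>U y\<bar>" using big W(3) by (simp add: d_def algebra_simps)
        ultimately obtain x where x: "x \<in> geom C" "U x = U y" "x w = d" using U_surj by blast
        have "1 - d / (2 - \<bar>U y\<bar>) = norm z" using W(2) by (simp add: d_def)
        then have "Q x = z" unfolding Q_def x(2,3) W(1) using zy by simp
        then have "H x = z" using HC[OF x(1)] by simp
        then show ?thesis using x(1) unfolding geom_Un by blast
      qed
    qed
  qed
  \<comment> \<open>On \<open>T\<close> and on \<open>L\<close> the coordinate of \<open>w\<close>
    is 0, so \<open>R\<close> does not shorten and \<open>Q\<close> has radius 1. Points of the
    wedge with positive weight at \<open>w\<close> have moved to the interior.\<close>
  have bdry1: "H x \<in> sphere 0 1" if "x \<in> geom (T \<union> L)" for x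
  proof -
    consider "x \<in> geom T" | "x \<in> geom L" using \<open>x \<in> geom (T \<union> L)\<close> unfolding geom_Un by blast
    then show ?thesis
    proof cases
      case 1
      then have x: "x \<in> geom ?S" "x w = 0" using geom_vertex_zero[OF T(1) 1 T(2)] by (auto simp: geom_Un)
      then have "H x = h x" using RS[OF x(1)] HD SD by auto
      then show ?thesis using hS[OF x(1)] by simp
    next
      case 2
      then have x: "x \<in> geom C" "x w = 0" using C(3) geom_vertex_zero[OF L(1) 2 L(3)] by auto
      then show ?thesis using HC[OF x(1)] hS[OF arcS(1)[OF Qf(4)[OF x(1)]]] by (simp add: Q_def)
    qed
  qed
  have bdry2: "sphere 0 1 \<subseteq> H ` geom (T \<union> L)"
  proof
    fix z :: complex assume z: "z \<in> sphere 0 1"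
    define y where "y = k z"
    have y: "y \<in> geom ?S" "h y = z" using kS[OF z] kh(2) z by (auto simp: y_def)
    consider "y \<in> geom T" | "y \<in> geom (wedge_cpx a w b)" using y(1) unfolding geom_Un by blast
    then show "z \<in> H ` geom (T \<union> L)"
    proof cases
      case 1
      have "y w = 0" using geom_vertex_zero[OF T(1) 1 T(2)] .
      then have "H y = z" using RS[OF y(1)] HD[of y] y SD by auto
      then show ?thesis using 1 unfolding geom_Un by blast
    next
      case 2
      note W = wedge[OF 2]
      have "U y \<in> {-1..1}" using W(2) by auto
      then obtain x where x: "x \<in> geom L" "U x = U y" using bij(2) by (metis imageE)
      have "x w = 0" "x \<in> geom C" using C(3) geom_vertex_zero[OF L(1) x(1) L(3)] x by auto
      then have "H x = z" using HC[of x] W(1) x(2) y(2) by (simp add: Q_def)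
      then show ?thesis using x(1) unfolding geom_Un by blast
    qed
  qed
  have simp_Un: "simplicial_cpx (A \<union> B)" if "simplicial_cpx A" "simplicial_cpx B" for A B :: "nat set set"
    using that unfolding simplicial_cpx_def by blast
  show ?thesis
  proof (rule disc_extending_1I[where h = H])
    show "simplicial_cpx (D' \<union> C)" using simp_Un h(1) C(1) by blast
    show "finite (D' \<union> C)" using h(2) C(2) by simp
    show "subcomplex (T \<union> L) (D' \<union> C)"
      using simp_Un[OF T(1) L(1)] h(3) by (auto simp: subcomplex_def cone_cpx_def)
    show "H ` geom (D' \<union> C) = cball 0 1" using imgD imgC onto by (auto simp: geom_Un)
    show "H ` geom (T \<union> L) = sphere 0 1" using bdry1 bdry2 by blast
  qed (use contH injH in auto)
qed

end

section \<open>Paths and cycles\<close>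

definition path_cpx :: "'a list \<Rightarrow> 'a set set" where
  "path_cpx ps = (\<lambda>v. {v}) ` set ps \<union> {{ps ! i, ps ! Suc i} | i. Suc i < length ps}"

lemma path_cpx_simps [simp]:
  "path_cpx [] = {}" "path_cpx [p] = {{p}}"
  "path_cpx (p # q # ps) = insert {p} (insert {p, q} (path_cpx (q # ps)))"
proof -
  have "{{(p # q # ps) ! i, (p # q # ps) ! Suc i} | i. Suc i < length (p # q # ps)} =
    insert {p, q} {{(q # ps) ! i, (q # ps) ! Suc i} | i. Suc i < length (q # ps)}" (is "?A = ?B")
  proof (rule Set.set_eqI)
    fix \<sigma>
    have "\<sigma> \<in> ?A \<longleftrightarrow> (\<exists>i. Suc i < length (p # q # ps) \<and> \<sigma> = {(p # q # ps) ! i, (p # q # ps) ! Suc i})" by blast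
    also have "\<dots> \<longleftrightarrow> \<sigma> = {p, q} \<or> (\<exists>i. Suc i < length (q # ps) \<and> \<sigma> = {(q # ps) ! i, (q # ps) ! Suc i})"
    proof
      assume "\<exists>i. Suc i < length (p # q # ps) \<and> \<sigma> = {(p # q # ps) ! i, (p # q # ps) ! Suc i}"
      then obtain i where "Suc i < length (p # q # ps)" "\<sigma> = {(p # q # ps) ! i, (p # q # ps) ! Suc i}" by blast
      then show "\<sigma> = {p, q} \<or> (\<exists>i. Suc i < length (q # ps) \<and> \<sigma> = {(q # ps) ! i, (q # ps) ! Suc i})"
        by (cases i) auto
    next
      assume "\<sigma> = {p, q} \<or> (\<exists>i. Suc i < length (q # ps) \<and> \<sigma> = {(q # ps) ! i, (q # ps) ! Suc i})"
      then show "\<exists>i. Suc i < length (p # q # ps) \<and> \<sigma> = {(p # q # ps) ! i, (p # q # ps) ! Suc i}"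
      proof
        assume "\<sigma> = {p, q}"
        then show ?thesis by (intro exI[of _ 0]) auto
      next
        assume "\<exists>i. Suc i < length (q # ps) \<and> \<sigma> = {(q # ps) ! i, (q # ps) ! Suc i}"
        then obtain i where "Suc i < length (q # ps)" "\<sigma> = {(q # ps) ! i, (q # ps) ! Suc i}" by blast
        then show ?thesis by (intro exI[of _ "Suc i"]) auto
      qed
    qed
    also have "\<dots> \<longleftrightarrow> \<sigma> \<in> ?B" by blast
    finally show "\<sigma> \<in> ?A \<longleftrightarrow> \<sigma> \<in> ?B" .
  qed
  then show "path_cpx (p # q # ps) = insert {p} (insert {p, q} (path_cpx (q # ps)))"
    unfolding path_cpx_def by auto
qed (auto simp: path_cpx_def)

text \<open>Cuts a path at a vertex kept by both pieces, which is how a cycle is split into two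
  arcs.\<close>

lemma path_cpx_append:
  "path_cpx (xs @ y # zs) = path_cpx (xs @ [y]) \<union> path_cpx (y # zs)"
proof (induction xs)
  case Nil
  then show ?case by (cases zs) auto
next
  case (Cons x xs)
  then show ?case by (cases xs) auto
qed

lemma simplicial_path: "simplicial_cpx (path_cpx ps)"
  unfolding simplicial_cpx_def
proof (intro ballI conjI allI impI)
  fix \<sigma> assume s: "\<sigma> \<in> path_cpx ps"
  show "finite \<sigma>" "\<sigma> \<noteq> {}" using s by (auto simp: path_cpx_def)
  fix \<tau> assume "\<tau> \<subseteq> \<sigma> \<and> \<tau> \<noteq> {}"
  then have t: "\<tau> \<in> Pow \<sigma> - {{}}" by simp
  from s consider v where "v \<in> set ps" "\<sigma> = {v}" | i where "Suc i < length ps" "\<sigma> = {ps ! i, ps ! Suc i}"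
    unfolding path_cpx_def by blast
  then show "\<tau> \<in> path_cpx ps"
  proof cases
    case 1
    then show ?thesis using t by (auto simp: path_cpx_def)
  next
    case 2
    then have "ps ! i \<in> set ps" "ps ! Suc i \<in> set ps" by auto
    then show ?thesis using t 2 unfolding path_cpx_def by (auto simp: Pow_insert)
  qed
qed

lemma finite_path: "finite (path_cpx ps)"
proof (rule finite_subset)
  show "path_cpx ps \<subseteq> Pow (set ps)"
    using nth_mem[of _ ps] unfolding path_cpx_def by fastforce
qed simp

lemma vertex_set_path [simp]: "vertex_set (path_cpx ps) = set ps"
proof -
  have "v \<in> set ps" if "{v} = {ps ! i, ps ! Suc i}" "Suc i < length ps" for v i
    using that nth_mem[of i ps] by (metis Suc_lessD insertI1 singletonD)
  then show ?thesis unfolding vertex_set_def path_cpx_def by blast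
qed

lemma path_edge_sub:
  assumes "\<sigma> \<in> path_cpx ps" "2 \<le> length ps"
  obtains i where "Suc i < length ps" "\<sigma> \<subseteq> {ps ! i, ps ! Suc i}"
proof -
  from assms(1) consider v where "v \<in> set ps" "\<sigma> = {v}" | i where "Suc i < length ps" "\<sigma> = {ps ! i, ps ! Suc i}"
    unfolding path_cpx_def by blast
  then show ?thesis
  proof cases
    case 1
    then obtain j where j: "j < length ps" "v = ps ! j" by (metis in_set_conv_nth)
    show ?thesis
    proof (cases "Suc j < length ps")
      case True
      then show ?thesis using that[of j] 1 j by auto
    next
      case False
      \<comment> \<open>\<open>j\<close> is the last position, so the edge ending there is
        used.\<close>
      then have "Suc (j - 1) = j" using j assms(2) by auto
      then show ?thesis using that[of "j - 1"] 1 j by auto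
    qed
  qed (use that in auto)
qed

section \<open>Arc coordinates on paths\<close>

definition edge_pt :: "'a \<Rightarrow> 'a \<Rightarrow> real \<Rightarrow> 'a \<Rightarrow> real" where
  "edge_pt p q t = (\<lambda>v. if v = p then 1 - t else if v = q then t else 0)"

lemma edge_pt_in_geom:
  assumes "simplicial_cpx K" "{p, q} \<in> K" "p \<noteq> q" "0 \<le> t" "t \<le> 1"
  shows "edge_pt p q t \<in> geom K"
  using assms(3-5) by (intro geomI[OF assms(1,2)]) (auto simp: edge_pt_def)

lemma geom_edgeE:
  assumes "x \<in> geom K" "{v. x v \<noteq> 0} \<subseteq> {p, q}" "p \<noteq> q"
  obtains t where "0 \<le> t" "t \<le> 1" "x = edge_pt p q t"
proof (rule that)
  have s: "sum x {p, q} = 1" by (rule geom_sum[OF assms(1)]) (use assms(2) in auto)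
  then have s': "x p + x q = 1" using assms(3) by simp
  show "0 \<le> x q" "x q \<le> 1" using geom_nonneg[OF assms(1), of p] geom_nonneg[OF assms(1), of q] s' by linarith+
  show "x = edge_pt p q (x q)"
  proof
    fix v show "x v = edge_pt p q (x q) v" using assms(2,3) s' by (auto simp: edge_pt_def)
  qed
qed

lemma geom_pathE:
  assumes "x \<in> geom (path_cpx ps)" "distinct ps" "2 \<le> length ps"
  obtains i t where "Suc i < length ps" "0 \<le> t" "t \<le> 1" "x = edge_pt (ps ! i) (ps ! Suc i) t"
proof -
  obtain i where i: "Suc i < length ps" "{v. x v \<noteq> 0} \<subseteq> {ps ! i, ps ! Suc i}"
    using path_edge_sub[OF geom_support[OF assms(1)] assms(3)] .
  have "ps ! i \<noteq> ps ! Suc i" using assms(2) i(1) by (simp add: nth_eq_iff_index_eq)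
  then obtain t where "0 \<le> t" "t \<le> 1" "x = edge_pt (ps ! i) (ps ! Suc i) t"
    using geom_edgeE[OF assms(1) i(2)] by blast
  then show ?thesis using that i by blast
qed

text \<open>Places the vertices at equal distances from -1 to 1. The position is recovered by
  \<open>inv_into\<close> because the coordinate has to be a linear sum over vertices, as the locale
  \<open>fan\<close> demands.\<close>

definition path_coeff :: "'a list \<Rightarrow> 'a \<Rightarrow> real" where
  "path_coeff ps v = 2 * real (inv_into {..<length ps} ((!) ps) v) / real (length ps - 1) - 1"

definition path_coord :: "'a list \<Rightarrow> ('a \<Rightarrow> real) \<Rightarrow> real" where
  "path_coord ps x = (\<Sum>v\<in>set ps. path_coeff ps v * x v)"

lemma path_coeff_nth:
  assumes "distinct ps" "i < length ps"
  shows "path_coeff ps (ps ! i) = 2 * real i / real (length ps - 1) - 1"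
proof -
  have "inv_into {..<length ps} ((!) ps) (ps ! i) = i"
    using assms by (intro inv_into_f_f) (auto simp: inj_on_def nth_eq_iff_index_eq)
  then show ?thesis by (simp add: path_coeff_def)
qed

lemma path_coord_edge_pt:
  assumes "p \<in> set ps" "q \<in> set ps" "p \<noteq> q"
  shows "path_coord ps (edge_pt p q t) = path_coeff ps p * (1 - t) + path_coeff ps q * t"
proof -
  have "path_coord ps (edge_pt p q t) = (\<Sum>v\<in>{p, q}. path_coeff ps v * edge_pt p q t v)"
    unfolding path_coord_def using assms by (intro sum.mono_neutral_right) (auto simp: edge_pt_def)
  then show ?thesis using assms by (simp add: edge_pt_def)
qed

lemma path_coord_nth:
  assumes "distinct ps" "Suc i < length ps"
  shows "path_coord ps (edge_pt (ps ! i) (ps ! Suc i) t) = 2 * (real i + t) / real (length ps - 1) - 1"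
proof -
  have ne: "ps ! i \<noteq> ps ! Suc i" using assms by (simp add: nth_eq_iff_index_eq)
  define m where "m = real (length ps - 1)"
  have m: "m \<noteq> 0" using assms(2) by (simp add: m_def)
  have "path_coord ps (edge_pt (ps ! i) (ps ! Suc i) t) =
      (2 * real i / m - 1) * (1 - t) + (2 * real (Suc i) / m - 1) * t"
    using path_coord_edge_pt[OF _ _ ne] path_coeff_nth[OF assms(1)] assms(2) by (simp add: m_def)
  also have "\<dots> = 2 * (real i + t) / m - 1" using m by (simp add: field_simps)
  finally show ?thesis by (simp add: m_def)
qed

lemma path_coord_bij:
  fixes ps :: "'a list"
  assumes "distinct ps" "2 \<le> length ps"
  shows "inj_on (path_coord ps) (geom (path_cpx ps))" "path_coord ps ` geom (path_cpx ps) = {-1..1}"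
proof -
  define m where "m = real (length ps - 1)"
  have m: "0 < m" using assms by (simp add: m_def)
  \<comment> \<open>Equal \<open>i + t\<close> on different edges is possible only at a shared
    vertex, where \<open>t = 1\<close> and \<open>s = 0\<close>.\<close>
  have edge_eq: "edge_pt (ps ! i) (ps ! Suc i) t = edge_pt (ps ! j) (ps ! Suc j) s"
    if "Suc i < length ps" "Suc j < length ps" "0 \<le> t" "t \<le> 1" "0 \<le> s" "s \<le> 1"
      "real i + t = real j + s" "i \<le> j" for i j t s
  proof (cases "i = j")
    case True
    then show ?thesis using that by simp
  next
    case False
    then have "real i + 1 \<le> real j" using that by simp
    then have ts: "t = 1" "s = 0" "real j = real i + 1" using that by linarith+
    then have "j = Suc i" by linarith
    moreover have "ps ! i \<noteq> ps ! Suc i" "ps ! Suc i \<noteq> ps ! Suc j" "ps ! i \<noteq> ps ! Suc j"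
      using assms(1) that \<open>j = Suc i\<close> by (auto simp: nth_eq_iff_index_eq)
    ultimately show ?thesis using ts \<open>j = Suc i\<close> by (auto simp: edge_pt_def fun_eq_iff)
  qed
  show "inj_on (path_coord ps) (geom (path_cpx ps))"
  proof (rule inj_onI)
    fix x y assume xy: "x \<in> geom (path_cpx ps)" "y \<in> geom (path_cpx ps)" "path_coord ps x = path_coord ps y"
    obtain i t where x: "Suc i < length ps" "0 \<le> t" "t \<le> 1" "x = edge_pt (ps ! i) (ps ! Suc i) t"
      using geom_pathE[OF xy(1) assms] .
    obtain j s where y: "Suc j < length ps" "0 \<le> s" "s \<le> 1" "y = edge_pt (ps ! j) (ps ! Suc j) s"
      using geom_pathE[OF xy(2) assms] .
    have "2 * (real i + t) / m - 1 = 2 * (real j + s) / m - 1"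
      using xy(3) path_coord_nth[OF assms(1) x(1)] path_coord_nth[OF assms(1) y(1)] x(4) y(4) by (simp add: m_def)
    then have "real i + t = real j + s" using m by simp
    then show "x = y"
      using edge_eq[OF x(1) y(1) x(2,3) y(2,3)] edge_eq[OF y(1) x(1) y(2,3) x(2,3)]
      unfolding x(4) y(4) by (metis nle_le)
  qed
  show "path_coord ps ` geom (path_cpx ps) = {-1..1}"
  proof
    show "path_coord ps ` geom (path_cpx ps) \<subseteq> {-1..1}"
    proof clarify
      fix x assume x: "x \<in> geom (path_cpx ps)"
      obtain i t where i: "Suc i < length ps" "0 \<le> t" "t \<le> 1" "x = edge_pt (ps ! i) (ps ! Suc i) t"
        using geom_pathE[OF x assms] .
      have "real i + t \<le> m" using i by (simp add: m_def)
      moreover have "path_coord ps x = 2 * ((real i + t) / m) - 1"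
        using path_coord_nth[OF assms(1) i(1)] i(4) by (simp add: m_def)
      moreover have "0 \<le> (real i + t) / m" using i m by simp
      moreover have "(real i + t) / m \<le> 1" using \<open>real i + t \<le> m\<close> m by simp
      ultimately show "path_coord ps x \<in> {-1..1}" unfolding atLeastAtMost_iff by linarith
    qed
    show "{-1..1} \<subseteq> path_coord ps ` geom (path_cpx ps)"
    proof
      fix u :: real assume u: "u \<in> {-1..1}"
      define \<tau> where "\<tau> = (u + 1) * m / 2"
      have \<tau>: "0 \<le> \<tau>" "\<tau> \<le> m" using u m by (auto simp: \<tau>_def)
      \<comment> \<open>At the right end the floor is \<open>length ps - 1\<close>, where no edge
        starts; the minimum falls back to the last edge, with parameter 1.\<close>
      define i where "i = min (nat \<lfloor>\<tau>\<rfloor>) (length ps - 2)"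
      have i: "Suc i < length ps" using assms(2) by (auto simp: i_def)
      have "real i \<le> \<tau>" using \<tau>(1) unfolding i_def by linarith
      moreover have "\<tau> \<le> real i + 1"
      proof (cases "nat \<lfloor>\<tau>\<rfloor> \<le> length ps - 2")
        case True
        then show ?thesis using \<tau>(1) by (simp add: i_def)
      next
        case False
        then show ?thesis using \<tau>(2) assms(2) by (simp add: i_def m_def)
      qed
      ultimately have t: "0 \<le> \<tau> - real i" "\<tau> - real i \<le> 1" by auto
      have ne: "ps ! i \<noteq> ps ! Suc i" using assms i by (simp add: nth_eq_iff_index_eq)
      have "{ps ! i, ps ! Suc i} \<in> path_cpx ps" using i by (auto simp: path_cpx_def)
      then have "edge_pt (ps ! i) (ps ! Suc i) (\<tau> - real i) \<in> geom (path_cpx ps)"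
        using edge_pt_in_geom[OF simplicial_path _ ne t] by blast
      moreover have "path_coord ps (edge_pt (ps ! i) (ps ! Suc i) (\<tau> - real i)) = u"

      proof -
        have "path_coord ps (edge_pt (ps ! i) (ps ! Suc i) (\<tau> - real i)) = 2 * \<tau> / m - 1"
          using path_coord_nth[OF assms(1) i, of "\<tau> - real i"] by (simp add: m_def)
        then show ?thesis using m by (simp add: \<tau>_def)
      qed
      ultimately show "u \<in> path_coord ps ` geom (path_cpx ps)" by (metis image_eqI)
    qed
  qed
qed

lemma path_coeff_ends:
  assumes "distinct ps" "2 \<le> length ps"
  shows "path_coeff ps (hd ps) = -1" "path_coeff ps (last ps) = 1"
proof -
  have ne: "ps \<noteq> []" using assms(2) by auto
  show "path_coeff ps (hd ps) = -1"
    using path_coeff_nth[OF assms(1), of 0] ne by (simp add: hd_conv_nth)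
  show "path_coeff ps (last ps) = 1"
  proof -
    define m where "m = real (length ps - 1)"
    have m: "m \<noteq> 0" using assms(2) by (simp add: m_def)
    have "path_coeff ps (last ps) = 2 * m / m - 1"
      using path_coeff_nth[OF assms(1), of "length ps - 1"] ne by (simp add: last_conv_nth m_def)
    then show ?thesis using m by simp
  qed
qed

lemma hd_neq_last:
  assumes "distinct ps" "2 \<le> length ps" shows "hd ps \<noteq> last ps"
proof -
  have "ps ! 0 \<noteq> ps ! (length ps - 1)" using assms by (subst nth_eq_iff_index_eq) auto
  moreover have "ps \<noteq> []" using assms(2) by auto
  ultimately show ?thesis by (simp add: hd_conv_nth last_conv_nth)
qed

lemma fan_path:
  assumes "distinct ps" "2 \<le> length ps" "w \<notin> set ps"
  shows "fan (hd ps) w (last ps) (path_cpx ps) (set ps) (path_coeff ps) (path_coord ps)"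
proof -
  have ne: "ps \<noteq> []" using assms(2) by auto
  have "{hd ps} \<in> path_cpx ps" "{last ps} \<in> path_cpx ps" using ne by (auto simp: path_cpx_def)
  moreover have pc: "path_coord ps = (\<lambda>x. \<Sum>v\<in>set ps. path_coeff ps v * x v)"
    by (rule ext) (rule path_coord_def)
  ultimately show ?thesis
    unfolding fan_def
    using assms ne hd_neq_last[OF assms(1,2)] path_coord_bij[OF assms(1,2)]
      path_coeff_ends[OF assms(1,2)] simplicial_path finite_path
    by (intro conjI pc) auto
qed

text \<open>A closed walk is still a list of consecutive edges, so the facts on
  \<open>path_cpx\<close> that do not ask for distinct vertices apply with the first vertex repeated
  at the end.\<close>

definition cycle_cpx :: "'a list \<Rightarrow> 'a set set" where
  "cycle_cpx ps = path_cpx (ps @ [hd ps])"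

lemma cycle_cpx_eq: "ps \<noteq> [] \<Longrightarrow> cycle_cpx ps = path_cpx ps \<union> path_cpx [last ps, hd ps]"
  using path_cpx_append[of "butlast ps" "last ps" "[hd ps]"]
  by (simp add: cycle_cpx_def) (metis append_butlast_last_id append_eq_append_conv2 append_Cons append_Nil append_assoc)

lemma vertex_set_cycle [simp]: "ps \<noteq> [] \<Longrightarrow> vertex_set (cycle_cpx ps) = set ps"
  by (simp add: cycle_cpx_def insert_absorb)

text \<open>Ensures that the closing edge of a cycle meets the path only in its ends and, later,
  that a fan meets the smaller disc only in the wedge.\<close>

lemma ends_not_edge:
  assumes "distinct ps" "3 \<le> length ps"
  shows "{last ps, hd ps} \<notin> path_cpx ps"
proof
  have ne: "ps \<noteq> []" using assms(2) by auto
  have hl: "hd ps \<noteq> last ps" using assms hd_neq_last[of ps] by simp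
  assume "{last ps, hd ps} \<in> path_cpx ps"
  then obtain i where i: "Suc i < length ps" "{last ps, hd ps} \<subseteq> {ps ! i, ps ! Suc i}"
    using path_edge_sub[of "{last ps, hd ps}" ps] assms(2) by auto
  have "last ps = ps ! (length ps - 1)" "hd ps = ps ! 0" using ne by (auto simp: last_conv_nth hd_conv_nth)
  then have "length ps - 1 \<in> {i, Suc i}" "0 \<in> {i, Suc i}"
    using i assms(1) ne by (auto simp: nth_eq_iff_index_eq)
  then show False using assms(2) by auto
qed

text \<open>\<open>?U\<close> maps both the path and the closing edge bijectively onto the interval.
  Taken as real part, it makes the path the upper half circle and the closing edge the lower one.
  The two meet where \<open>?U\<close> is 1 or -1, and there the imaginary part is 0.\<close>

lemma cycle_homeomorphic_circle:
  fixes ps :: "nat list"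
  assumes "distinct ps" "3 \<le> length ps"
  shows "triangulates_sphere 1 (cycle_cpx ps)"
proof -
  let ?a = "hd ps" and ?b = "last ps" and ?U = "path_coord ps"
  let ?P = "path_cpx ps" and ?E = "path_cpx [last ps, hd ps]"
  have ne: "ps \<noteq> []" and l2: "2 \<le> length ps" using assms(2) by auto
  have hl: "?a \<noteq> ?b" using assms hd_neq_last[of ps] by simp
  have cE: "cycle_cpx ps = ?P \<union> ?E" by (rule cycle_cpx_eq[OF ne])
  note bij = path_coord_bij[OF assms(1) l2]
  have contU: "continuous_on A ?U" for A
    unfolding path_coord_def by (intro continuous_intros continuous_on_coord)
  have UE: "?U (edge_pt ?b ?a t) = 1 - 2 * t" for t
    using path_coord_edge_pt[of ?b ps ?a t] ne hl path_coeff_ends[OF assms(1) l2] by auto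
  have EE: "\<exists>t. 0 \<le> t \<and> t \<le> 1 \<and> x = edge_pt ?b ?a t" if "x \<in> geom ?E" for x
    using geom_pathE[OF that] hl by auto
  have bijE: "inj_on ?U (geom ?E)" "?U ` geom ?E = {-1..1}"
  proof -
    show "inj_on ?U (geom ?E)"
    proof (rule inj_onI)
      fix x y assume x: "x \<in> geom ?E" and y: "y \<in> geom ?E" and U: "?U x = ?U y"
      obtain t where t: "x = edge_pt ?b ?a t" using EE[OF x] by blast
      obtain s where s: "y = edge_pt ?b ?a s" using EE[OF y] by blast
      have "1 - 2 * t = 1 - 2 * s" using U UE unfolding t s by metis
      then show "x = y" by (simp add: s t)
    qed
    show "?U ` geom ?E = {-1..1}"
    proof
      show "?U ` geom ?E \<subseteq> {-1..1}" using EE UE by fastforce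
      show "{-1..1} \<subseteq> ?U ` geom ?E"
      proof
        fix u :: real assume "u \<in> {-1..1}"
        then have "edge_pt ?b ?a ((1 - u) / 2) \<in> geom ?E"
          using hl by (intro edge_pt_in_geom[OF simplicial_path]) auto
        moreover have "?U (edge_pt ?b ?a ((1 - u) / 2)) = u" by (simp add: UE field_simps)
        ultimately show "u \<in> ?U ` geom ?E" by (metis image_eqI)
      qed
    qed
  qed
  \<comment> \<open>With equal end points the first branch of \<open>edge_pt\<close> decides, so
    this is the vertex \<open>v\<close> with weight 1.\<close>
  define pt where "pt v = edge_pt v v (0::real)" for v :: nat
  have ptP: "pt v \<in> geom ?P" if "v \<in> set ps" for v
    by (rule geomI[OF simplicial_path, of "{v}"]) (use that in \<open>auto simp: pt_def edge_pt_def path_cpx_def\<close>)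
  have ptE: "pt v \<in> geom ?E" if "v \<in> {?a, ?b}" for v
    by (rule geomI[OF simplicial_path, of "{v}"]) (use that in \<open>auto simp: pt_def edge_pt_def\<close>)
  have ptU: "?U (pt ?b) = 1" "?U (pt ?a) = -1"
  proof -
    have "pt ?b = edge_pt ?b ?a 0" "pt ?a = edge_pt ?b ?a 1" using hl by (auto simp: pt_def edge_pt_def fun_eq_iff)
    then show "?U (pt ?b) = 1" "?U (pt ?a) = -1" using UE[of 0] UE[of 1] by simp_all
  qed
  have cross: "x = y" if xy: "x \<in> geom ?P" "y \<in> geom ?E" "?U x = ?U y" "\<bar>?U x\<bar> = 1" for x y
  proof -
    obtain v where v: "v \<in> {?a, ?b}" "?U x = ?U (pt v)" using xy(4) ptU by (metis abs_eq_iff abs_1 insertCI)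
    have "v \<in> set ps" using v(1) ne by auto
    then have "x = pt v" using inj_onD[OF bij(1) v(2) xy(1)] ptP by blast
    moreover have "y = pt v" using inj_onD[OF bijE(1) _ xy(2)] ptE v xy(3) by metis
    ultimately show ?thesis by simp
  qed
  have meet: "\<bar>?U x\<bar> = 1" if x: "x \<in> geom ?P" "x \<in> geom ?E" for x
  proof -
    obtain t where t: "x = edge_pt ?b ?a t" "0 \<le> t" "t \<le> 1" using EE[OF x(2)] by blast
    have "{v. x v \<noteq> 0} \<noteq> {?b, ?a}" using ends_not_edge[OF assms] geom_support[OF x(1)] by auto
    then have "t = 0 \<or> t = 1" using t(1) hl by (auto simp: edge_pt_def split: if_splits)
    then show ?thesis using UE t(1) by auto
  qed
  define q where "q u = sqrt (1 - u\<^sup>2)" for u :: real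
  have q0: "q u = 0 \<longleftrightarrow> \<bar>u\<bar> = 1" if "\<bar>u\<bar> \<le> 1" for u
    using that by (auto simp: q_def abs_square_eq_1 power2_eq_1_iff abs_if split: if_splits)
  have qn: "0 \<le> q u" "(q u)\<^sup>2 = 1 - u\<^sup>2" if "\<bar>u\<bar> \<le> 1" for u
    using that abs_square_le_1[of u] by (auto simp: q_def)
  have U1: "\<bar>?U x\<bar> \<le> 1" if "x \<in> geom ?P \<or> x \<in> geom ?E" for x
  proof -
    have "?U x \<in> {-1..1}" using that bij(2) bijE(2) by blast
    then show ?thesis by auto
  qed
  define f where "f x = (if x \<in> geom ?P then Complex (?U x) (q (?U x)) else Complex (?U x) (- q (?U x)))" for x
  have fP: "f x = Complex (?U x) (q (?U x))" if "x \<in> geom ?P" for x using that by (simp add: f_def)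
  have fE: "f x = Complex (?U x) (- q (?U x))" if "x \<in> geom ?E" for x
    using meet[of x] that q0[of "?U x"] U1 by (auto simp: f_def)
  have simpl: "simplicial_cpx (cycle_cpx ps)" "finite (cycle_cpx ps)"
    unfolding cycle_cpx_def by (rule simplicial_path finite_path)+
  show ?thesis
  proof (rule triangulates_circleI[OF simpl, of f])
    have c: "continuous_on A (\<lambda>x. Complex (?U x) (s * q (?U x)))" for A s
      unfolding Complex_eq q_def by (intro continuous_intros contU)
    show "continuous_on (geom (cycle_cpx ps)) f"
      unfolding cE geom_Un f_def
    proof (rule continuous_on_cases)
      show "closed (geom ?P)" "closed (geom ?E)"
        using compact_geom[OF simplicial_path finite_path] compact_imp_closed by blast+
      show "continuous_on (geom ?P) (\<lambda>x. Complex (?U x) (q (?U x)))" using c[of _ 1] by simp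
      show "continuous_on (geom ?E) (\<lambda>x. Complex (?U x) (- q (?U x)))" using c[of _ "-1"] by simp
      show "\<forall>x. x \<in> geom ?P \<and> x \<notin> geom ?P \<or> x \<in> geom ?E \<and> x \<in> geom ?P \<longrightarrow>
          Complex (?U x) (q (?U x)) = Complex (?U x) (- q (?U x))"
        using fP fE by metis
    qed
    have injPE: "x = y" if "x \<in> geom ?P" "y \<in> geom ?E" "f x = f y" for x y
    proof -
      have e: "?U x = ?U y" "q (?U x) = - q (?U y)" using that fP fE by auto
      then have "q (?U x) = 0" using qn(1)[OF U1, of x] that by simp
      then show ?thesis using cross that e(1) q0[OF U1, of x] by blast
    qed
    show "inj_on f (geom (cycle_cpx ps))"
      unfolding cE geom_Un
    proof (rule inj_onI)
      fix x y assume xy: "x \<in> geom ?P \<union> geom ?E" "y \<in> geom ?P \<union> geom ?E" "f x = f y"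
      then have "?U x = ?U y" using fP fE by (auto simp: f_def split: if_splits)
      then show "x = y"
        using xy injPE[of x y] injPE[of y x] inj_onD[OF bij(1), of x y] inj_onD[OF bijE(1), of x y] by auto
    qed
    show "f ` geom (cycle_cpx ps) = sphere 0 1"
    proof
      show "f ` geom (cycle_cpx ps) \<subseteq> sphere 0 1"
      proof clarify
        fix x assume "x \<in> geom (cycle_cpx ps)"
        then have x: "x \<in> geom ?P \<or> x \<in> geom ?E" unfolding cE geom_Un by blast
        then have "cmod (f x) = sqrt ((?U x)\<^sup>2 + (q (?U x))\<^sup>2)" by (auto simp: f_def cmod_def)
        then show "f x \<in> sphere 0 1" using qn(2)[OF U1[OF x]] by simp
      qed
      show "sphere 0 1 \<subseteq> f ` geom (cycle_cpx ps)"
      proof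
        fix z :: complex assume "z \<in> sphere 0 1"
        then have z: "(Re z)\<^sup>2 + (Im z)\<^sup>2 = 1" by (simp add: cmod_def)
        then have "(Im z)\<^sup>2 = 1 - (Re z)\<^sup>2" by simp
        then have qz: "q (Re z) = \<bar>Im z\<bar>" by (simp add: q_def flip: \<open>(Im z)\<^sup>2 = 1 - (Re z)\<^sup>2\<close>)
        have "(Re z)\<^sup>2 \<le> 1" using z by (metis le_add_same_cancel1 zero_le_power2)
        then have r: "Re z \<in> {-1..1}" using abs_square_le_1[of "Re z"] by auto
        show "z \<in> f ` geom (cycle_cpx ps)"
        proof (cases "0 \<le> Im z")
          case True
          obtain x where x: "x \<in> geom ?P" "?U x = Re z" using r bij(2) by (metis imageE)
          then have "f x = z" using fP qz True by (simp add: complex_eq_iff)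
          then show ?thesis using x(1) unfolding cE geom_Un by blast
        next
          case False
          obtain x where x: "x \<in> geom ?E" "?U x = Re z" using r bijE(2) by (metis imageE)
          then have "f x = z" using fE qz False by (simp add: complex_eq_iff)
          then show ?thesis using x(1) unfolding cE geom_Un by blast
        qed
      qed
    qed
  qed
qed

section \<open>Triangulated circles are cycles\<close>

lemma circle_minus_point:
  assumes "cmod z = 1"
  shows "sphere 0 1 - {z} = (\<lambda>t. z * cis t) ` {0<..<2 * pi}"
proof
  show "sphere 0 1 - {z} \<subseteq> (\<lambda>t. z * cis t) ` {0<..<2 * pi}"
  proof
    fix w assume w: "w \<in> sphere 0 1 - {z}"
    have n: "cmod (w / z) = 1" using w assms by (simp add: norm_divide)
    then have e: "w / z = cis (Arg2pi (w / z))" using Arg2pi_eq[of "w / z"] by (simp add: cis_conv_exp)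
    have z0: "z \<noteq> 0" using assms by auto
    have "Arg2pi (w / z) \<noteq> 0"
    proof
      assume "Arg2pi (w / z) = 0"
      then have "w / z = 1" using e by (metis cis_zero)
      then show False using w z0 by simp
    qed
    then have "Arg2pi (w / z) \<in> {0<..<2 * pi}" using Arg2pi_ge_0[of "w / z"] Arg2pi_lt_2pi[of "w / z"] by auto
    moreover have "w = z * cis (Arg2pi (w / z))" using e z0 by (simp add: field_simps)
    ultimately show "w \<in> (\<lambda>t. z * cis t) ` {0<..<2 * pi}" by blast
  qed
  show "(\<lambda>t. z * cis t) ` {0<..<2 * pi} \<subseteq> sphere 0 1 - {z}"
  proof clarify
    fix t :: real assume t: "t \<in> {0<..<2 * pi}"
    have "z * cis t \<noteq> z"
    proof
      assume "z * cis t = z"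
      moreover have "z \<noteq> 0" using assms by auto
      ultimately have "cis t = 1" by simp
      then have "cos t = 1" by (metis cis.simps(1) one_complex.simps(1))
      then obtain m :: int where m: "t = real_of_int m * (2 * pi)"
        using cos_one_2pi_int[of t] by (auto simp: mult.assoc)
      have "0 * (2 * pi) < real_of_int m * (2 * pi)" "real_of_int m * (2 * pi) < 1 * (2 * pi)"
        using t m by auto
      then have "0 < real_of_int m" "real_of_int m < 1"
        using mult_less_cancel_right_pos[of "2 * pi"] pi_gt_zero by (metis mult_pos_pos zero_less_numeral)+
      then show False by simp
    qed
    then show "z * cis t \<in> sphere 0 1 - {z}" using assms by (simp add: norm_mult)
  qed
qed

text \<open>\<open>Z\<close> may be empty, since the level set deleted in
  \<open>circle_degree\<close> may be.\<close>

lemma connected_circle_minus: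
  assumes "Z \<subseteq> {z}"
  shows "connected (sphere (0::complex) 1 - Z)"
proof (cases "z \<in> sphere 0 1 \<and> Z = {z}")
  case True
  have "connected ((\<lambda>t. z * cis t) ` {0<..<2 * pi})"
    by (intro connected_continuous_image continuous_intros connected_Ioo)
  then show ?thesis using circle_minus_point[of z] True by simp
next
  case False
  then have "sphere 0 1 - Z = sphere 0 1" using assms by blast
  then show ?thesis using connected_sphere[of "0::complex" 1] by simp
qed

text \<open>The mean of \<open>g 1\<close> and \<open>g (-1)\<close> is taken at some point other
  than 1 and -1. Without that point the circle is still connected, so the same value is taken
  again.\<close>

lemma no_injection_circle_real:
  fixes g :: "complex \<Rightarrow> real"
  assumes "continuous_on (sphere 0 1) g"
  shows "\<not> inj_on g (sphere 0 1)"
proof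
  assume inj: "inj_on g (sphere 0 1)"
  have between: "c \<in> g ` (sphere 0 1 - Z)" if Z: "Z \<subseteq> {z}" "1 \<notin> Z" "-1 \<notin> Z"
    and c: "g 1 \<le> c \<and> c \<le> g (-1) \<or> g (-1) \<le> c \<and> c \<le> g 1" for Z z c
  proof -
    have "connected (g ` (sphere 0 1 - Z))"
      using connected_circle_minus[OF Z(1)] assms by (intro connected_continuous_image) (auto intro: continuous_on_subset)
    moreover have "g 1 \<in> g ` (sphere 0 1 - Z)" "g (-1) \<in> g ` (sphere 0 1 - Z)" using Z by auto
    ultimately show ?thesis using c unfolding connected_iff_interval by blast
  qed
  define c where "c = (g 1 + g (-1)) / 2"
  have ne: "g 1 \<noteq> g (-1)" using inj_onD[OF inj, of 1 "-1"] by auto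
  have c: "g 1 \<le> c \<and> c \<le> g (-1) \<or> g (-1) \<le> c \<and> c \<le> g 1" by (auto simp: c_def)
  obtain z where z: "z \<in> sphere 0 1" "g z = c" using between[of "{}" 0 c] c by auto
  have "z \<noteq> 1" "z \<noteq> -1" using z(2) ne by (auto simp: c_def field_simps)
  then have "c \<in> g ` (sphere 0 1 - {z})" using between[of "{z}" z c] c by auto
  then show False using inj z by (auto simp: inj_on_def)
qed

text \<open>If \<open>p\<close> were missed, dividing by \<open>p\<close> would move the gap to 1,
  where \<open>Arg2pi\<close> has its cut; the argument would then be a continuous injection of the
  circle into the reals.\<close>

lemma circle_injection_onto:
  fixes f :: "complex \<Rightarrow> complex"
  assumes "continuous_on (sphere 0 1) f" "inj_on f (sphere 0 1)" "f ` sphere 0 1 \<subseteq> sphere 0 1"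
  shows "f ` sphere 0 1 = sphere 0 1"
proof (rule ccontr)
  assume "f ` sphere 0 1 \<noteq> sphere 0 1"
  then obtain p where p: "p \<in> sphere 0 1" "p \<notin> f ` sphere 0 1" using assms(3) by blast
  have p0: "p \<noteq> 0" using p by auto
  define h where "h z = f z / p" for z
  have h1: "cmod (h z) = 1" if "z \<in> sphere 0 1" for z
  proof -
    have "f z \<in> sphere 0 1" using assms(3) that by blast
    then show ?thesis using p(1) by (simp add: h_def norm_divide)
  qed
  have eq: "h z = cis (Arg2pi (h z))" if "z \<in> sphere 0 1" for z
    using Arg2pi_eq[of "h z"] h1[OF that] by (simp add: cis_conv_exp)
  have "h z \<notin> \<real>\<^sub>\<ge>\<^sub>0" if "z \<in> sphere 0 1" for z
  proof
    assume "h z \<in> \<real>\<^sub>\<ge>\<^sub>0"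
    then have "h z = 1" using h1[OF that] by (auto elim!: nonneg_Reals_cases)
    then show False using p p0 that by (auto simp: h_def)
  qed
  then have "continuous_on (h ` sphere 0 1) Arg2pi"
    by (intro continuous_at_imp_continuous_on) (auto intro: continuous_at_Arg2pi)
  moreover have ch: "continuous_on (sphere 0 1) h"
    unfolding h_def using p0 by (intro continuous_intros assms(1)) auto
  ultimately have "continuous_on (sphere 0 1) (\<lambda>z. Arg2pi (h z))"
    by (rule continuous_on_compose2) (rule order_refl)
  moreover have "inj_on (\<lambda>z. Arg2pi (h z)) (sphere 0 1)"
  proof (rule inj_onI)
    fix x y assume xy: "x \<in> sphere 0 1" "y \<in> sphere 0 1" "Arg2pi (h x) = Arg2pi (h y)"
    then have "h x = h y" using eq by metis
    then have "f x = f y" using p0 by (simp add: h_def)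
    then show "x = y" using assms(2) xy by (meson inj_onD)
  qed
  ultimately show False using no_injection_circle_real by blast
qed

text \<open>The barycentre of a simplex has that simplex as its support, so a simplex can be read
  off from the realization.\<close>

lemma simplicial_subset_geom:
  assumes "simplicial_cpx K" "geom K \<subseteq> geom L"
  shows "K \<subseteq> L"
proof
  fix \<sigma> assume s: "\<sigma> \<in> K"
  have f: "finite \<sigma>" "\<sigma> \<noteq> {}" using assms(1) s unfolding simplicial_cpx_def by blast+
  define t where "t = (\<lambda>v. if v \<in> \<sigma> then 1 / real (card \<sigma>) else 0)"
  have c: "real (card \<sigma>) > 0" using f by (simp add: card_gt_0_iff)
  have "t \<in> geom K"
  proof (rule geomI[OF assms(1) s])
    show "sum t \<sigma> = 1" using c by (simp add: t_def)
  qed (auto simp: t_def)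
  then have "{v. t v \<noteq> 0} \<in> L" using assms(2) geom_support by blast
  moreover have "{v. t v \<noteq> 0} = \<sigma>" using c by (auto simp: t_def)
  ultimately show "\<sigma> \<in> L" by simp
qed

text \<open>Composing the two parametrizations embeds the circle in itself. By
  \<open>circle_injection_onto\<close> this is onto, so the cycle already covers the realization of
  \<open>S\<close>.\<close>

lemma circle_contains_cycle:
  fixes S :: "nat set set"
  assumes S: "triangulates_sphere 1 S" and ps: "distinct ps" "3 \<le> length ps" "cycle_cpx ps \<subseteq> S"
  shows "S = cycle_cpx ps"
proof -
  let ?C = "cycle_cpx ps"
  have sS: "simplicial_cpx S" "finite S" using S by (auto simp: triangulates_sphere_def)
  have sC: "simplicial_cpx ?C" "finite ?C" unfolding cycle_cpx_def by (rule simplicial_path finite_path)+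
  obtain f where f: "continuous_on (geom S) f" "inj_on f (geom S)" "f ` geom S = sphere (0::complex) 1"
    using triangulates_circleE[OF S] .
  obtain g where g: "continuous_on (geom ?C) g" "inj_on g (geom ?C)" "g ` geom ?C = sphere (0::complex) 1"
    using triangulates_circleE[OF cycle_homeomorphic_circle[OF ps(1,2)]] .
  obtain k where k: "homeomorphism (geom ?C) (sphere 0 1) g k"
    using homeomorphism_compact[OF compact_geom[OF sC] g(1,3,2)] by blast
  have sub: "geom ?C \<subseteq> geom S" using geom_mono[OF ps(3)] .
  have kC: "k ` sphere 0 1 = geom ?C" "continuous_on (sphere 0 1) k" "inj_on k (sphere 0 1)"
    using k by (auto simp: homeomorphism_def intro: inj_on_inverseI)
  have "(f \<circ> k) ` sphere 0 1 = sphere 0 1"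
  proof (rule circle_injection_onto)
    have "continuous_on (k ` sphere 0 1) f" using f(1) sub kC(1) continuous_on_subset by metis
    then show "continuous_on (sphere 0 1) (f \<circ> k)" using continuous_on_compose kC(2) by blast
    have "inj_on f (k ` sphere 0 1)" using f(2) sub kC(1) inj_on_subset by metis
    then show "inj_on (f \<circ> k) (sphere 0 1)" using comp_inj_on kC(3) by blast
    show "(f \<circ> k) ` sphere 0 1 \<subseteq> sphere 0 1" unfolding image_comp[symmetric] kC(1) using f(3) sub by blast
  qed
  then have "f ` geom ?C = f ` geom S" unfolding image_comp[symmetric] kC(1) f(3) .
  then have "geom ?C = geom S" using inj_on_image_eq_iff[OF f(2) sub order_refl] by simp
  then show ?thesis using simplicial_subset_geom[OF sS(1), of ?C] ps(3) by auto
qed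

lemma path_card_le_2:
  assumes "\<sigma> \<in> path_cpx ps"
  shows "card \<sigma> \<le> 2"
proof -
  have "card {p, q} \<le> 2" for p q :: 'a by (cases "p = q") auto
  then show ?thesis using assms unfolding path_cpx_def by auto
qed

text \<open>The boundary of a triangle in \<open>S\<close> is a cycle and would be all of
  \<open>S\<close>, which leaves no room for the triangle.\<close>

lemma circle_card_le_2:
  assumes S: "triangulates_sphere 1 S" and \<sigma>: "\<sigma> \<in> S"
  shows "card \<sigma> \<le> 2"
proof (rule ccontr)
  assume "\<not> card \<sigma> \<le> 2"
  then have "3 \<le> card \<sigma>" by simp
  have sS: "simplicial_cpx S" using S by (auto simp: triangulates_sphere_def)
  obtain T where T: "T \<subseteq> \<sigma>" "card T = 3" using obtain_subset_with_card_n[OF \<open>3 \<le> card \<sigma>\<close>] by blast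
  then obtain a b c where abc: "T = {a, b, c}" "a \<noteq> b" "a \<noteq> c" "b \<noteq> c" by (metis card_3_iff)
  have face: "\<tau> \<in> S" if "\<tau> \<subseteq> {a, b, c}" "\<tau> \<noteq> {}" for \<tau>
    using simplicial_cpx_face[OF sS \<sigma>] that T(1) abc(1) by blast
  have "cycle_cpx [a, b, c] \<subseteq> S" by (auto simp: cycle_cpx_def intro!: face)
  then have "S = cycle_cpx [a, b, c]" using circle_contains_cycle[OF S] abc by auto
  then have "{a, b, c} \<in> path_cpx ([a, b, c] @ [a])" using face[of "{a, b, c}"] by (simp add: cycle_cpx_def)
  then have "card {a, b, c} \<le> 2" by (rule path_card_le_2)
  then show False using T abc by simp
qed

text \<open>Otherwise the edge to \<open>u\<close> is the only possible one at \<open>v\<close>, and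
  at most one point has weight 1/2 at \<open>v\<close>. Deleting it keeps the circle connected, yet
  the weight at \<open>v\<close> still takes the values 0 and 1 and skips 1/2.\<close>

lemma circle_degree:
  assumes S: "triangulates_sphere 1 S" and v: "{v} \<in> S"
  shows "\<exists>x. x \<noteq> u \<and> x \<noteq> v \<and> {v, x} \<in> S"
proof (rule ccontr)
  assume no: "\<nexists>x. x \<noteq> u \<and> x \<noteq> v \<and> {v, x} \<in> S"
  have sS: "simplicial_cpx S" "finite S" using S by (auto simp: triangulates_sphere_def)
  obtain f where f: "continuous_on (geom S) f" "inj_on f (geom S)" "f ` geom S = sphere (0::complex) 1"
    using triangulates_circleE[OF S] .
  obtain k where k: "homeomorphism (geom S) (sphere 0 1) f k"
    using homeomorphism_compact[OF compact_geom[OF sS] f(1,3,2)] by blast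
  define X where "X = {t \<in> geom S. t v = 1 / 2}"
  have X: "t = edge_pt v u (1 / 2)" if "t \<in> X" for t
  proof -
    have t: "t \<in> geom S" "t v = 1 / 2" using that by (auto simp: X_def)
    let ?\<sigma> = "{x. t x \<noteq> 0}"
    have \<sigma>: "?\<sigma> \<in> S" using geom_support[OF t(1)] .
    have fin: "finite ?\<sigma>" using simplicial_cpx_finite[OF sS(1) \<sigma>] .
    have "sum t ?\<sigma> = 1" using t(1) by (simp add: geom_def)
    then have "?\<sigma> \<noteq> {v}" using t(2) by auto
    then obtain x where x: "x \<in> ?\<sigma>" "x \<noteq> v" using t(2) by fastforce
    have "?\<sigma> = {v, x}"
    proof (rule sym, rule card_seteq[OF fin])
      show "{v, x} \<subseteq> ?\<sigma>" using x t(2) by auto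
      show "card ?\<sigma> \<le> card {v, x}" using circle_card_le_2[OF S \<sigma>] x(2) by simp
    qed
    then have "x = u" using no x(2) \<sigma> by auto
    then have "{x. t x \<noteq> 0} \<subseteq> {v, u}" "v \<noteq> u" using \<open>?\<sigma> = {v, x}\<close> x(2) by auto
    then obtain s where s: "t = edge_pt v u s" using geom_edgeE[OF t(1)] by blast
    then have "s = 1 / 2" using t(2) by (simp add: edge_pt_def)
    then show ?thesis unfolding s by (rule arg_cong)
  qed
  have "f ` X \<subseteq> {f (edge_pt v u (1 / 2))}" using X by blast
  then have "connected (sphere 0 1 - f ` X)" by (rule connected_circle_minus)
  moreover have "geom S - X = k ` (sphere 0 1 - f ` X)"
  proof -
    have "sphere 0 1 - f ` X = f ` (geom S - X)"
      using inj_on_image_set_diff[OF f(2), of "geom S" X] f(3) by (simp add: X_def)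
    moreover have "k ` f ` (geom S - X) = geom S - X"
      using k by (force simp: homeomorphism_def image_image)
    ultimately show ?thesis by simp
  qed
  moreover have "continuous_on (sphere 0 1 - f ` X) k"
    using k by (auto simp: homeomorphism_def intro: continuous_on_subset)
  ultimately have "connected (geom S - X)" using connected_continuous_image by metis
  then have conn: "connected ((\<lambda>t. t v) ` (geom S - X))"
    by (rule connected_continuous_image[rotated]) (rule continuous_on_coord)
  define d where "d x = (\<lambda>i. if i = x then 1 else (0::real))" for x :: nat
  have d: "d x \<in> geom S" if "{x} \<in> S" for x
    by (rule geomI[OF sS(1) that]) (auto simp: d_def)
  \<comment> \<open>A second vertex supplies the weight 0; with \<open>v\<close> alone the
    realization would be a single point.\<close>
  have "\<exists>y. y \<noteq> v \<and> {y} \<in> S"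
  proof (rule ccontr)
    assume "\<nexists>y. y \<noteq> v \<and> {y} \<in> S"
    then have only: "y = v" if "{y} \<in> S" for y using that by blast
    have "t = d v" if t: "t \<in> geom S" for t
    proof -
      have "{x. t x \<noteq> 0} \<subseteq> {v}"
        using only simplicial_cpx_face[OF sS(1) geom_support[OF t]] by blast
      moreover then have "sum t {v} = 1" by (intro geom_sum[OF t]) auto
      ultimately show ?thesis by (auto simp: d_def fun_eq_iff)
    qed
    then have "f ` geom S \<subseteq> {f (d v)}" by blast
    moreover have "(1::complex) \<in> f ` geom S" "(-1::complex) \<in> f ` geom S" unfolding f(3) by auto
    ultimately have "(1::complex) = f (d v)" "(-1::complex) = f (d v)" by blast+
    then show False by (metis one_neq_neg_one)
  qed
  then obtain y where y: "y \<noteq> v" "{y} \<in> S" by blast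
  have "d v \<in> geom S - X" "d y \<in> geom S - X" using d v y by (auto simp: X_def d_def)
  then have "d v v \<in> (\<lambda>t. t v) ` (geom S - X)" "d y v \<in> (\<lambda>t. t v) ` (geom S - X)" by blast+
  moreover have "d v v = 1" "d y v = 0" using y by (auto simp: d_def)
  ultimately have "1 \<in> (\<lambda>t. t v) ` (geom S - X)" "0 \<in> (\<lambda>t. t v) ` (geom S - X)" by metis+
  then have "1 / 2 \<in> (\<lambda>t. t v) ` (geom S - X)"
    using conn[unfolded connected_iff_interval, rule_format, of 0 1 "1 / 2"] by simp
  then show False by (auto simp: X_def)
qed

text \<open>The first vertex of a longest path has a neighbour besides the second vertex. By
  maximality it lies on the path, which closes up to a cycle, and
  \<open>circle_contains_cycle\<close> leaves nothing outside that cycle.\<close>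

lemma triangulated_circle_is_cycle:
  assumes S: "triangulates_sphere 1 S"
  obtains ps where "distinct ps" "3 \<le> length ps" "S = cycle_cpx ps"
proof -
  have sS: "simplicial_cpx S" "finite S" using S by (auto simp: triangulates_sphere_def)
  define Q where "Q ps \<longleftrightarrow> distinct ps \<and> ps \<noteq> [] \<and> path_cpx ps \<subseteq> S" for ps
  have finV: "finite (vertex_set S)"
    using finite_vertex_set sS by blast
  have bound: "length ps \<le> card (vertex_set S)" if "Q ps" for ps
  proof -
    have "set ps \<subseteq> vertex_set S" using that by (auto simp: Q_def vertex_set_def path_cpx_def)
    then show ?thesis using card_mono[OF finV] that by (metis Q_def distinct_card)
  qed
  obtain f where f: "f ` geom S = sphere (0::complex) 1" using triangulates_circleE[OF S] .
  have "geom S \<noteq> {}"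
  proof
    assume "geom S = {}"
    then have "sphere (0::complex) 1 = {}" using f by simp
    then show False by simp
  qed
  then obtain \<sigma> where \<sigma>: "\<sigma> \<in> S" using geom_support by blast
  then obtain v where "v \<in> \<sigma>" using sS unfolding simplicial_cpx_def by blast
  then have "{v} \<in> S" using simplicial_cpx_face[OF sS(1) \<sigma>] by blast
  then have "Q [v]" by (simp add: Q_def)
  then obtain ps where ps: "Q ps" "\<And>qs. Q qs \<Longrightarrow> length qs \<le> length ps"
    using ex_has_greatest_nat[of Q "[v]" length "Suc (card (vertex_set S))"] bound
    by (metis le_imp_less_Suc)
  have dps: "distinct ps" "ps \<noteq> []" "path_cpx ps \<subseteq> S" using ps(1) by (auto simp: Q_def)
  let ?a = "hd ps"
  have "{?a} \<in> S" using dps by (auto simp: path_cpx_def)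
  \<comment> \<open>If \<open>ps\<close> has a single vertex then \<open>ps ! 1\<close> is
    unspecified, and avoiding that value as well does no harm.\<close>
  then obtain x where x: "x \<noteq> ps ! 1" "x \<noteq> ?a" "{?a, x} \<in> S" using circle_degree[OF S] by blast
  have x1: "{x} \<in> S" using simplicial_cpx_face[OF sS(1) x(3)] by blast
  have "x \<in> set ps"
  proof (rule ccontr)
    assume "x \<notin> set ps"
    moreover have "path_cpx (x # ps) \<subseteq> S" using dps x(3) x1 by (cases ps) (auto simp: insert_commute)
    ultimately have "Q (x # ps)" using dps by (simp add: Q_def)
    then show False using ps(2) by fastforce
  qed
  then obtain j where j: "j < length ps" "ps ! j = x" by (metis in_set_conv_nth)
  have "j \<noteq> 0" using j x(2) dps(2) by (metis hd_conv_nth)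
  moreover have "j \<noteq> 1" using j x(1) by auto
  ultimately have j2: "2 \<le> j" by simp
  \<comment> \<open>The initial segment up to \<open>x\<close>, closed by the edge from
    \<open>x\<close> back to the start; \<open>2 \<le> j\<close> gives it at least three
    vertices.\<close>
  define cs where "cs = take (Suc j) ps"
  have cs: "distinct cs" "length cs = Suc j" "cs \<noteq> []" using dps j by (auto simp: cs_def)
  have hl: "hd cs = ?a" "last cs = x" using cs(2,3) j dps(2)
    by (auto simp: cs_def hd_conv_nth last_conv_nth)
  have "path_cpx cs \<subseteq> path_cpx ps"
  proof -
    have "ps = cs @ drop (Suc j) ps" by (simp add: cs_def)
    then show ?thesis
      using path_cpx_append[of "butlast cs" "last cs" "drop (Suc j) ps"] cs(3)
      by (metis Un_upper1 append.assoc append_Cons append_Nil append_butlast_last_id)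
  qed
  moreover have "path_cpx [last cs, hd cs] \<subseteq> S" using hl x x1 \<open>{?a} \<in> S\<close> by (simp add: insert_commute)
  ultimately have "cycle_cpx cs \<subseteq> S" using cycle_cpx_eq[OF cs(3)] dps(3) by auto
  then show ?thesis using that[of cs] circle_contains_cycle[OF S cs(1)] cs(1,2) j2 by auto
qed

section \<open>Filling loops\<close>

text \<open>Ampleness is applied to the image of the vertices with \<open>A\<close> the whole
  induced subcomplex, so that \<open>y\<close> spans a simplex with every simplex there. If \<alpha>
  is not injective, the image only has fewer vertices.\<close>

lemma ample_cone:
  assumes Y: "ample r Y" and L: "simplicial_cpx L" "finite (vertex_set L)" "card (vertex_set L) \<le> r"
    and \<alpha>: "simplicial_map L Y \<alpha>"
  obtains y where "{y} \<in> Y" "\<And>\<tau>. \<tau> \<in> L \<Longrightarrow> insert y (\<alpha> ` \<tau>) \<in> Y"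
proof -
  let ?U = "\<alpha> ` vertex_set L" and ?A = "induced_cpx Y (\<alpha> ` vertex_set L)"
  have sY: "simplicial_cpx Y" using Y by (simp add: ample_def)
  have "\<alpha> ` {v} \<in> Y" if "v \<in> vertex_set L" for v
    using \<alpha> that unfolding simplicial_map_def vertex_set_def by blast
  then have "?U \<subseteq> vertex_set Y" by (auto simp: vertex_set_def)
  moreover have "card ?U \<le> r" using card_image_le[OF L(2), of \<alpha>] L(3) by simp
  moreover have "subcomplex ?A ?A"
    unfolding subcomplex_def simplicial_cpx_def
  proof (intro conjI ballI allI impI order_refl)
    fix \<sigma> assume \<sigma>: "\<sigma> \<in> ?A"
    then show "finite \<sigma>" "\<sigma> \<noteq> {}" using sY unfolding induced_cpx_def simplicial_cpx_def by blast+
    fix \<tau> assume "\<tau> \<subseteq> \<sigma> \<and> \<tau> \<noteq> {}"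
    then show "\<tau> \<in> ?A" using \<sigma> simplicial_cpx_face[OF sY, of \<sigma> \<tau>] unfolding induced_cpx_def by blast
  qed
  ultimately obtain y where y: "y \<in> vertex_set Y - ?U" "link Y y \<inter> ?A = ?A"
    using Y L(2) unfolding ample_def by (metis finite_imageI)
  show ?thesis
  proof (rule that)
    show "{y} \<in> Y" using y by (simp add: vertex_set_def)
    fix \<tau> assume \<tau>: "\<tau> \<in> L"
    then have "\<alpha> ` \<tau> \<in> ?A" using \<alpha> simplex_in_vertex_set[OF L(1) \<tau>]
      unfolding simplicial_map_def induced_cpx_def by blast
    then have "\<alpha> ` \<tau> \<in> link Y y" using y(2) by blast
    then show "insert y (\<alpha> ` \<tau>) \<in> Y" by (simp add: link_def)
  qed
qed

lemma vertex_set_Un: "vertex_set (K \<union> L) = vertex_set K \<union> vertex_set L"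
  by (auto simp: vertex_set_def)

lemma vertex_set_cone:
  assumes "simplicial_cpx L"
  shows "vertex_set (cone_cpx w L) = insert w (vertex_set L)"
proof -
  have "v = w" if "{v} = insert w \<tau>" for v and \<tau> :: "'a set" using that by blast
  then show ?thesis unfolding vertex_set_def cone_cpx_def by blast
qed

lemma simplicial_map_cone:
  assumes "simplicial_map L Y \<alpha>" and L: "simplicial_cpx L"
    and "{\<beta> w} \<in> Y" "\<And>\<tau>. \<tau> \<in> L \<Longrightarrow> insert (\<beta> w) (\<alpha> ` \<tau>) \<in> Y"
    and eq: "\<And>v. v \<in> vertex_set L \<Longrightarrow> \<beta> v = \<alpha> v"
  shows "simplicial_map (cone_cpx w L) Y \<beta>"
  unfolding simplicial_map_def
proof
  have im: "\<beta> ` \<tau> = \<alpha> ` \<tau>" if "\<tau> \<in> L" for \<tau>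
    using eq simplex_in_vertex_set[OF L that] by (intro image_cong) auto
  fix \<sigma> assume "\<sigma> \<in> cone_cpx w L"
  then consider "\<sigma> = {w}" | "\<sigma> \<in> L" | \<tau> where "\<tau> \<in> L" "\<sigma> = insert w \<tau>" by (auto simp: cone_cpx_def)
  then show "\<beta> ` \<sigma> \<in> Y"
  proof cases
    case 2
    then show ?thesis using im assms(1) by (simp add: simplicial_map_def)
  next
    case 3
    then show ?thesis using im assms(4) by simp
  qed (use assms in simp)
qed

text \<open>A triangle of the cone is an edge joined to \<open>w\<close>. Edges are counted by
  position in the list, so the bound also covers a closed walk, where it counts the edges of a
  cycle.\<close>

lemma card_triangles_cone_path:
  assumes w: "w \<notin> set qs"
  shows "card {\<sigma> \<in> cone_cpx w (path_cpx qs). card \<sigma> = 3} \<le> length qs - 1"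
proof -
  have "{\<sigma> \<in> cone_cpx w (path_cpx qs). card \<sigma> = 3}
      \<subseteq> (\<lambda>i. insert w {qs ! i, qs ! Suc i}) ` {..<length qs - 1}"
  proof
    fix \<sigma> assume "\<sigma> \<in> {\<sigma> \<in> cone_cpx w (path_cpx qs). card \<sigma> = 3}"
    then have \<sigma>: "\<sigma> \<in> cone_cpx w (path_cpx qs)" "card \<sigma> = 3" by auto
    from \<sigma>(1) consider "\<sigma> = {w}" | "\<sigma> \<in> path_cpx qs" | \<tau> where "\<tau> \<in> path_cpx qs" "\<sigma> = insert w \<tau>"
      unfolding cone_cpx_def by blast
    then show "\<sigma> \<in> (\<lambda>i. insert w {qs ! i, qs ! Suc i}) ` {..<length qs - 1}"
    proof cases
      case 1
      then show ?thesis using \<sigma>(2) by simp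
    next
      case 2
      then show ?thesis using \<sigma>(2) path_card_le_2[OF 2] by simp
    next
      case 3
      from 3(1) consider v where "\<tau> = {v}" | i where "Suc i < length qs" "\<tau> = {qs ! i, qs ! Suc i}"
        unfolding path_cpx_def by blast
      then show ?thesis
      proof cases
        case 1
        have "card (insert w {v}) \<le> 2" by (cases "w = v") auto
        then show ?thesis using \<sigma>(2) 3(2) 1 by simp
      next
        case 2
        then show ?thesis using 3(2) by (intro image_eqI[of _ _ i]) auto
      qed
    qed
  qed
  then have "card {\<sigma> \<in> cone_cpx w (path_cpx qs). card \<sigma> = 3}
      \<le> card ((\<lambda>i. insert w {qs ! i, qs ! Suc i}) ` {..<length qs - 1})"
    by (rule card_mono[rotated]) simp
  also have "\<dots> \<le> length qs - 1" using card_image_le[of "{..<length qs - 1}"] by (metis card_lessThan finite_lessThan)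
  finally show ?thesis .
qed

lemma fill_loop_cone:
  fixes Y :: "'a set set"
  assumes Y: "ample r Y" and ps: "distinct ps" "3 \<le> length ps" "length ps \<le> r"
    and \<alpha>: "simplicial_map (cycle_cpx ps) Y \<alpha>" and w: "w \<notin> set ps"
  shows "\<exists>D \<beta>. disc_extending 1 (cycle_cpx ps) D \<and> simplicial_map D Y \<beta> \<and> (\<forall>v\<in>set ps. \<beta> v = \<alpha> v) \<and>
    vertex_set D = insert w (set ps) \<and> card {\<sigma> \<in> D. card \<sigma> = 3} \<le> length ps"
proof -
  let ?C = "cycle_cpx ps"
  have ne: "ps \<noteq> []" using ps by auto
  have sC: "simplicial_cpx ?C" unfolding cycle_cpx_def by (rule simplicial_path)
  have vC: "vertex_set ?C = set ps" using vertex_set_cycle[OF ne] .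
  have "card (set ps) \<le> r" using ps distinct_card[OF ps(1)] by simp
  then obtain y where y: "{y} \<in> Y" "\<And>\<tau>. \<tau> \<in> ?C \<Longrightarrow> insert y (\<alpha> ` \<tau>) \<in> Y"
    using ample_cone[OF Y sC _ _ \<alpha>] vC by (metis List.finite_set)
  show ?thesis
  proof (intro exI conjI)
    show "disc_extending 1 ?C (cone_cpx w ?C)"
      using disc_extending_cone[OF cycle_homeomorphic_circle[OF ps(1,2)]] w vC by simp
    show "simplicial_map (cone_cpx w ?C) Y (\<alpha>(w := y))"
      by (rule simplicial_map_cone[OF \<alpha> sC]) (use y w vC in auto)
    show "\<forall>v\<in>set ps. (\<alpha>(w := y)) v = \<alpha> v" using w by auto
    show "vertex_set (cone_cpx w ?C) = insert w (set ps)" using vertex_set_cone[OF sC] vC by simp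
    \<comment> \<open>The closed walk has one entry more than \<open>ps\<close>, which cancels the
      \<open>- 1\<close> of the count.\<close>
    have "w \<notin> set (ps @ [hd ps])" using w ne by auto
    from card_triangles_cone_path[OF this]
    show "card {\<sigma> \<in> cone_cpx w ?C. card \<sigma> = 3} \<le> length ps" by (simp add: cycle_cpx_def)
  qed
qed

text \<open>Induction on a bound \<open>k\<close> for the number of fans before the last cone: one
  fan shortens the loop by \<open>r - 3\<close>, and \<open>3 + (r - 3) = r\<close> is the length at
  which a single cone suffices. The interior has to avoid \<open>F\<close>, which is arbitrary so
  that the induction hypothesis can be used with a larger set.\<close>

lemma fill_loop:
  fixes Y :: "'a set set"
  assumes Y: "ample r Y" and r: "4 \<le> r"
  shows "distinct ps \<Longrightarrow> 4 \<le> length ps \<Longrightarrow> length ps \<le> 3 + Suc k * (r - 3) \<Longrightarrow>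
    simplicial_map (cycle_cpx ps) Y \<alpha> \<Longrightarrow> finite F \<Longrightarrow>
    \<exists>D \<beta>. disc_extending 1 (cycle_cpx ps) D \<and> simplicial_map D Y \<beta> \<and> (\<forall>v\<in>set ps. \<beta> v = \<alpha> v) \<and>
      (vertex_set D - set ps) \<inter> F = {} \<and> card (vertex_set D - set ps) \<le> Suc k \<and>
      card {\<sigma> \<in> D. card \<sigma> = 3} \<le> Suc k * (r - 1) + 1"
proof (induction k arbitrary: ps \<alpha> F)
  \<comment> \<open>Stated for every \<open>k\<close>, since a short loop may also occur in the
    induction step.\<close>
  have small: "\<exists>D \<beta>. disc_extending 1 (cycle_cpx ps) D \<and> simplicial_map D Y \<beta> \<and> (\<forall>v\<in>set ps. \<beta> v = \<alpha> v) \<and>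
      (vertex_set D - set ps) \<inter> F = {} \<and> card (vertex_set D - set ps) \<le> Suc k \<and>
      card {\<sigma> \<in> D. card \<sigma> = 3} \<le> Suc k * (r - 1) + 1"
    if ps: "distinct ps" "4 \<le> length ps" "length ps \<le> r"
      and \<alpha>: "simplicial_map (cycle_cpx ps) Y \<alpha>" and F: "finite F" for ps \<alpha> F k
  proof -
    obtain w where w: "w \<notin> set ps \<union> F" using ex_new_if_finite[OF infinite_UNIV_nat] F by (metis List.finite_set finite_UnI)
    then obtain D \<beta> where D: "disc_extending 1 (cycle_cpx ps) D" "simplicial_map D Y \<beta>" "\<forall>v\<in>set ps. \<beta> v = \<alpha> v"
      "vertex_set D = insert w (set ps)" "card {\<sigma> \<in> D. card \<sigma> = 3} \<le> length ps"
      using fill_loop_cone[OF Y ps(1) _ ps(3) \<alpha>, of w] ps(2) by auto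
    have "vertex_set D - set ps = {w}" using D(4) w by auto
    moreover have "length ps \<le> Suc k * (r - 1) + 1" using ps(3) r by simp
    ultimately show ?thesis using D w by (intro exI[of _ D] exI[of _ \<beta>]) auto
  qed
  {
    case 0
    then show ?case using r by (intro small) auto
  next
    case (Suc k)
    show ?case
    proof (cases "length ps \<le> r")
      case True
      then show ?thesis using Suc.prems by (intro small)
    next
      case False
      define qs rest where "qs = take r ps" and "rest = drop r ps"
      have psq: "ps = qs @ rest" by (simp add: qs_def rest_def)
      have lq: "length qs = r" using False by (simp add: qs_def)
      have qne: "qs \<noteq> []" using lq r by auto
      have rne: "rest \<noteq> []" using False by (simp add: rest_def)
      have dq: "distinct qs" "distinct rest" "set qs \<inter> set rest = {}" using Suc.prems(1) unfolding psq by auto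
      let ?a = "hd qs" and ?b = "last qs"
      have ab: "?a \<noteq> ?b" "?a \<in> set qs" "?b \<in> set qs" using hd_neq_last[OF dq(1)] lq r qne by auto
      obtain w where w: "w \<notin> set ps \<union> F"
        using ex_new_if_finite[OF infinite_UNIV_nat] Suc.prems(5) by (metis List.finite_set finite_UnI)
      have wq: "w \<notin> set qs" "w \<notin> set rest" using w psq by auto
      \<comment> \<open>The loop in which a bypass through \<open>w\<close> replaces the inner
        vertices of the arc; the smaller disc fills it and the fan is attached along the
        bypass.\<close>
      let ?ps' = "?a # w # ?b # rest"
      let ?L = "path_cpx qs" and ?T = "path_cpx (?b # rest @ [?a])" and ?W = "wedge_cpx ?a w ?b"
      have hdps: "hd ps = ?a" using psq qne by simp
      have cyc: "cycle_cpx ps = ?T \<union> ?L"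
      proof -
        have "ps @ [hd ps] = butlast qs @ ?b # (rest @ [?a])" using psq qne hdps by simp
        then have "cycle_cpx ps = path_cpx (butlast qs @ [?b]) \<union> ?T"
          unfolding cycle_cpx_def using path_cpx_append[of "butlast qs" ?b "rest @ [?a]"] by metis
        then show ?thesis using qne by (simp add: Un_commute)
      qed
      have cyc': "cycle_cpx ?ps' = ?T \<union> ?W"
        using path_cpx_append[of "[?a, w]" ?b "rest @ [?a]"]
        by (auto simp: cycle_cpx_def wedge_cpx_def)
      have sL: "simplicial_cpx ?L" and sT: "simplicial_cpx ?T" by (rule simplicial_path)+
      have \<alpha>L: "simplicial_map ?L Y \<alpha>" and \<alpha>T: "simplicial_map ?T Y \<alpha>"
        using Suc.prems(4) cyc by (auto simp: simplicial_map_def)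
      have "card (set qs) \<le> r" using distinct_card[OF dq(1)] lq by simp
      then obtain y where y: "{y} \<in> Y" "\<And>\<tau>. \<tau> \<in> ?L \<Longrightarrow> insert y (\<alpha> ` \<tau>) \<in> Y"
        using ample_cone[OF Y sL _ _ \<alpha>L] by (metis List.finite_set vertex_set_path)
      define \<alpha>' where "\<alpha>' = \<alpha>(w := y)"
      have d': "distinct ?ps'" using dq ab wq by auto
      have wT: "w \<notin> vertex_set ?T" using wq ab by auto
      have \<alpha>': "simplicial_map (cycle_cpx ?ps') Y \<alpha>'"
        unfolding simplicial_map_def cyc'
      proof
        fix \<sigma> assume "\<sigma> \<in> ?T \<union> ?W"
        then show "\<alpha>' ` \<sigma> \<in> Y"
        proof
          assume \<sigma>: "\<sigma> \<in> ?T"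
          then have "w \<notin> \<sigma>" using simplex_in_vertex_set[OF sT \<sigma>] wT by blast
          then have "\<alpha>' ` \<sigma> = \<alpha> ` \<sigma>" by (auto simp: \<alpha>'_def)
          then show ?thesis using \<alpha>T \<sigma> by (simp add: simplicial_map_def)
        next
          assume \<sigma>: "\<sigma> \<in> ?W"
          have "{?a} \<in> ?L" "{?b} \<in> ?L" using ab by (auto simp: path_cpx_def)
          then have "{\<alpha> ?a} \<in> Y" "{\<alpha> ?b} \<in> Y" "{y, \<alpha> ?a} \<in> Y" "{y, \<alpha> ?b} \<in> Y"
            using y(2)[of "{?a}"] y(2)[of "{?b}"] \<alpha>L by (auto simp: simplicial_map_def)
          moreover have "\<alpha>' ?a = \<alpha> ?a" "\<alpha>' ?b = \<alpha> ?b" "\<alpha>' w = y" using ab wq by (auto simp: \<alpha>'_def)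
          ultimately show ?thesis using \<sigma> y(1) by (auto simp: wedge_cpx_def insert_commute)
        qed
      qed
      have len: "length ?ps' = length ps - (r - 3)" using psq lq r by simp
      have l3: "r - 3 \<le> length ps" "length ps \<le> 3 + (r - 3) + Suc k * (r - 3)" using False Suc.prems(3) by auto
      \<comment> \<open>\<open>rest\<close> contributes a fourth vertex, so the induction never
        meets a loop with three vertices.\<close>
      have len4: "4 \<le> length ?ps'" using rne by (cases rest) auto
      have lenk: "length ?ps' \<le> 3 + Suc k * (r - 3)" using len l3 by linarith
      \<comment> \<open>Adding \<open>set ps\<close> keeps the deleted inner vertices of the arc out
        of the smaller disc.\<close>
      have finF: "finite (F \<union> set ps)" using Suc.prems(5) by simp
      obtain D' \<beta>' where D': "disc_extending 1 (cycle_cpx ?ps') D'" "simplicial_map D' Y \<beta>'"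
        "\<forall>v\<in>set ?ps'. \<beta>' v = \<alpha>' v" "(vertex_set D' - set ?ps') \<inter> (F \<union> set ps) = {}"
        "card (vertex_set D' - set ?ps') \<le> Suc k" "card {\<sigma> \<in> D'. card \<sigma> = 3} \<le> Suc k * (r - 1) + 1"
        using Suc.IH[OF d' len4 lenk \<alpha>' finF] by blast
      let ?C = "cone_cpx w ?L"
      have sD': "simplicial_cpx D'" "finite D'" "cycle_cpx ?ps' \<subseteq> D'"
        using D'(1) by (auto simp: disc_extending_def subcomplex_def)
      interpret fan ?a w ?b ?L "set qs" "path_coeff qs" "path_coord qs"
        by (rule fan_path) (use dq lq r wq in auto)
      have VD': "vertex_set D' \<inter> set qs \<subseteq> {?a, ?b}"
        using D'(4) dq wq psq by auto
      have int: "D' \<inter> ?C = ?W"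
      proof
        show "?W \<subseteq> D' \<inter> ?C" using wedge_sub_C sD'(3) cyc' by blast
        show "D' \<inter> ?C \<subseteq> ?W"
        proof
          fix \<sigma> assume "\<sigma> \<in> D' \<inter> ?C"
          then have \<sigma>: "\<sigma> \<in> D'" "\<sigma> \<in> ?C" by auto
          have sub: "\<sigma> \<subseteq> vertex_set D'" using simplex_in_vertex_set[OF sD'(1) \<sigma>(1)] .
          have edge: "\<tau> = {?a} \<or> \<tau> = {?b}" if \<tau>: "\<tau> \<in> ?L" "\<tau> \<subseteq> \<sigma>" for \<tau>
          proof -
            have "\<tau> \<subseteq> {?a, ?b}" using simplex_in_vertex_set[OF sL \<tau>(1)] \<tau>(2) sub VD' by auto
            moreover have "\<tau> \<noteq> {}" using sL \<tau>(1) unfolding simplicial_cpx_def by blast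
            \<comment> \<open>The induction hypothesis does not keep an edge between the two ends
              out of \<open>D'\<close>; what excludes it is that the arc does not contain
              it.\<close>
            moreover have "\<tau> \<noteq> {?b, ?a}" using ends_not_edge[OF dq(1)] lq r \<tau>(1) by auto
            ultimately show ?thesis by blast
          qed
          from \<sigma>(2) consider "\<sigma> = {w}" | "\<sigma> \<in> ?L" | \<tau> where "\<tau> \<in> ?L" "\<sigma> = insert w \<tau>"
            unfolding cone_cpx_def by blast
          then show "\<sigma> \<in> ?W"
          proof cases
            case 1
            then show ?thesis by (simp add: wedge_cpx_def)
          next
            case 2
            then show ?thesis using edge[OF 2] by (auto simp: wedge_cpx_def)
          next
            case 3
            have "\<tau> = {?a} \<or> \<tau> = {?b}" using edge[OF 3(1)] 3(2) by blast
            then show ?thesis using 3(2) by (auto simp: wedge_cpx_def insert_commute)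
          qed
        qed
      qed
      define D where "D = D' \<union> ?C"
      \<comment> \<open>\<beta> has to return to \<alpha> on the inner vertices of the arc, where
        \<open>\<beta>'\<close> is uncontrolled. On \<open>D'\<close> nothing changes, as its
        vertices in \<open>set ps\<close> all belong to \<open>?ps'\<close>.\<close>
      define \<beta> where "\<beta> v = (if v \<in> set ps then \<alpha> v else \<beta>' v)" for v
      have \<beta>D': "\<beta> v = \<beta>' v" if v: "v \<in> vertex_set D'" for v
      proof (cases "v \<in> set ps")
        case True
        then have "v \<in> set ?ps'" using v D'(4) by blast
        then show ?thesis using D'(3) True w by (auto simp: \<beta>_def \<alpha>'_def)
      qed (simp add: \<beta>_def)
      have "disc_extending 1 (cycle_cpx ps) D"
        using disc_extending_fan[OF D'(1)[unfolded cyc'] sT wT int] unfolding cyc D_def .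
      moreover have "simplicial_map D Y \<beta>"
      proof -
        have "simplicial_map D' Y \<beta>"
          unfolding simplicial_map_def
        proof
          fix \<sigma> assume \<sigma>: "\<sigma> \<in> D'"
          have "\<beta> ` \<sigma> = \<beta>' ` \<sigma>"
            using \<beta>D' simplex_in_vertex_set[OF sD'(1) \<sigma>] by (intro image_cong) auto
          then show "\<beta> ` \<sigma> \<in> Y" using D'(2) \<sigma> by (simp add: simplicial_map_def)
        qed
        moreover have "simplicial_map ?C Y \<beta>"
        proof (rule simplicial_map_cone[OF \<alpha>L sL])
          have "\<beta> w = y" using w D'(3) by (auto simp: \<beta>_def \<alpha>'_def)
          then show "{\<beta> w} \<in> Y" "\<And>\<tau>. \<tau> \<in> ?L \<Longrightarrow> insert (\<beta> w) (\<alpha> ` \<tau>) \<in> Y" using y by auto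
          show "\<And>v. v \<in> vertex_set ?L \<Longrightarrow> \<beta> v = \<alpha> v" using psq by (auto simp: \<beta>_def)
        qed
        ultimately show ?thesis by (auto simp: D_def simplicial_map_def)
      qed
      moreover have "\<forall>v\<in>set ps. \<beta> v = \<alpha> v" by (simp add: \<beta>_def)
      moreover
      have VD: "vertex_set D - set ps \<subseteq> insert w (vertex_set D' - set ?ps')"
        using vertex_set_cone[OF sL, of w] ab psq unfolding D_def vertex_set_Un by auto
      then have "(vertex_set D - set ps) \<inter> F = {}" using D'(4) w by blast
      moreover have "card (vertex_set D - set ps) \<le> Suc (Suc k)"
      proof -
        have finD': "finite (vertex_set D')"
          using finite_vertex_set sD' by blast
        then have "card (vertex_set D - set ps) \<le> card (insert w (vertex_set D' - set ?ps'))"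
          using VD by (intro card_mono) auto
        also have "\<dots> \<le> Suc (card (vertex_set D' - set ?ps'))" using finD' by (simp add: card_insert_if)
        finally show ?thesis using D'(5) by simp
      qed
      moreover have "card {\<sigma> \<in> D. card \<sigma> = 3} \<le> Suc (Suc k) * (r - 1) + 1"
      proof -
        have "{\<sigma> \<in> D. card \<sigma> = 3} = {\<sigma> \<in> D'. card \<sigma> = 3} \<union> {\<sigma> \<in> ?C. card \<sigma> = 3}" by (auto simp: D_def)
        then have "card {\<sigma> \<in> D. card \<sigma> = 3} \<le> card {\<sigma> \<in> D'. card \<sigma> = 3} + card {\<sigma> \<in> ?C. card \<sigma> = 3}"
          by (simp add: card_Un_le)
        also have "\<dots> \<le> (Suc k * (r - 1) + 1) + (r - 1)"
          using D'(6) card_triangles_cone_path[OF wq(1)] lq by (intro add_mono) auto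
        finally show ?thesis by simp
      qed
      ultimately show ?thesis by blast
    qed
  }
qed

text \<open>For connectedness alone an internal vertex costs nothing. This settles the 0-sphere and
  every loop with at most \<open>r\<close> vertices, including a loop of three vertices whose image
  is not a simplex.\<close>

lemma fill_sphere_cone:
  fixes Y :: "'a set set" and S :: "nat set set"
  assumes Y: "ample r Y" and S: "triangulates_sphere n S" and card: "card (vertex_set S) \<le> r"
    and \<alpha>: "simplicial_map S Y \<alpha>"
  shows "\<exists>D \<beta>. disc_extending n S D \<and> simplicial_map D Y \<beta> \<and> (\<forall>v\<in>vertex_set S. \<beta> v = \<alpha> v)"
proof -
  have sS: "simplicial_cpx S" "finite S" using S by (auto simp: triangulates_sphere_def)
  have fin: "finite (vertex_set S)"
    using finite_vertex_set sS by blast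
  obtain w where w: "w \<notin> vertex_set S" using ex_new_if_finite[OF infinite_UNIV_nat fin] by blast
  obtain y where y: "{y} \<in> Y" "\<And>\<tau>. \<tau> \<in> S \<Longrightarrow> insert y (\<alpha> ` \<tau>) \<in> Y"
    using ample_cone[OF Y sS(1) fin card \<alpha>] by blast
  have "simplicial_map (cone_cpx w S) Y (\<alpha>(w := y))"
    by (rule simplicial_map_cone[OF \<alpha> sS(1)]) (use y w in auto)
  then show ?thesis using disc_extending_cone[OF S w] w
    by (intro exI[of _ "cone_cpx w S"] exI[of _ "\<alpha>(w := y)"]) auto
qed

text \<open>Vertices are distinct points of the realization, and the 0-sphere has only two.\<close>

lemma card_vertices_sphere_0:
  assumes "triangulates_sphere 0 S"
  shows "card (vertex_set S) \<le> 2"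
proof -
  have sS: "simplicial_cpx S" using assms by (auto simp: triangulates_sphere_def)
  obtain f where f: "inj_on f (geom S)" "f ` geom S = usphere 0" using triangulates_sphereE[OF assms] .
  define d where "d x = (\<lambda>i. if i = x then 1 else (0::real))" for x :: nat
  have d: "d x \<in> geom S" if "x \<in> vertex_set S" for x
    by (rule geomI[OF sS, of "{x}"]) (use that in \<open>auto simp: d_def vertex_set_def\<close>)
  have "inj d" by (auto simp: inj_def d_def fun_eq_iff)
  have s0: "usphere 0 \<subseteq> {\<lambda>i. if i = 0 then 1 else 0, \<lambda>i. if i = 0 then -1 else 0}"
    by (auto simp: usphere_def fun_eq_iff power2_eq_1_iff)
  have fs: "finite (usphere 0)" using finite_subset[OF s0] by simp
  have "card (vertex_set S) \<le> card (usphere 0)"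
  proof (rule card_inj_on_le[OF _ _ fs, of "f \<circ> d"])
    have "d ` vertex_set S \<subseteq> geom S" using d by blast
    then show "(f \<circ> d) ` vertex_set S \<subseteq> usphere 0" using f(2) by auto
    show "inj_on (f \<circ> d) (vertex_set S)"
      using \<open>inj d\<close> f(1) \<open>d ` vertex_set S \<subseteq> geom S\<close> by (meson comp_inj_on inj_on_subset subset_UNIV)
  qed
  also have "\<dots> \<le> card {\<lambda>i::nat. if i = 0 then 1 else (0::real), \<lambda>i. if i = 0 then -1 else 0}"
    by (rule card_mono[OF _ s0]) simp
  also have "\<dots> \<le> 2" by (simp add: card_insert_if)
  finally show ?thesis .
qed

text \<open>For \<open>n = 3\<close> the bounds allow no internal vertex and one triangle, so the
  disc must be the full triangle and the image of the loop a simplex. Ampleness with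
  \<open>A\<close> the two ends of an edge yields triangles in \<open>Y\<close> whose edges are
  present but whose interior is not, hence the condition on this case.\<close>

theorem proposition4p1:
  fixes Y :: "'a set set" and r :: nat
  assumes "4 \<le> r" and "ample r Y"
  shows "simply_connected_cpx Y \<and>
    (\<forall>(S :: nat set set) (\<alpha> :: nat \<Rightarrow> 'a) (n :: nat).
       triangulates_sphere 1 S \<and> card (vertex_set S) = n \<and> simplicial_map S Y \<alpha> \<and>
       (n = 3 \<longrightarrow> \<alpha> ` vertex_set S \<in> Y) \<longrightarrow>
       (\<exists>(D :: nat set set) (\<beta> :: nat \<Rightarrow> 'a).
          disc_extending 1 S D \<and> simplicial_map D Y \<beta> \<and>
          (\<forall>v\<in>vertex_set S. \<beta> v = \<alpha> v) \<and>
          int (card (vertex_set D - vertex_set S)) \<le> \<lceil>(real n - 3) / (real r - 3)\<rceil> \<and>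
          int (card {\<sigma> \<in> D. card \<sigma> = 3})
            \<le> \<lceil>(real n - 3) / (real r - 3)\<rceil> * (int r - 1) + 1))"
proof -
  have loops: "\<exists>D \<beta>. disc_extending 1 S D \<and> simplicial_map D Y \<beta> \<and> (\<forall>v\<in>vertex_set S. \<beta> v = \<alpha> v) \<and>
      int (card (vertex_set D - vertex_set S)) \<le> \<lceil>(real n - 3) / (real r - 3)\<rceil> \<and>
      int (card {\<sigma> \<in> D. card \<sigma> = 3}) \<le> \<lceil>(real n - 3) / (real r - 3)\<rceil> * (int r - 1) + 1"
    if S: "triangulates_sphere 1 S" and n: "card (vertex_set S) = n" and \<alpha>: "simplicial_map S Y \<alpha>"
      and n3: "n = 3 \<longrightarrow> \<alpha> ` vertex_set S \<in> Y" for S n and \<alpha> :: "nat \<Rightarrow> 'a"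
  proof -
    obtain ps where ps: "distinct ps" "3 \<le> length ps" "S = cycle_cpx ps"
      using triangulated_circle_is_cycle[OF S] .
    have vS: "vertex_set S = set ps" using ps by (metis vertex_set_cycle list.size(3) not_numeral_le_zero)
    have ln: "length ps = n" using n distinct_card[OF ps(1)] vS by simp
    show ?thesis
    proof (cases "n = 3")
      case True
      obtain a b c where abc: "ps = [a, b, c]" using ln True by (auto simp: numeral_3_eq_3 length_Suc_conv)
      have ne: "a \<noteq> b" "a \<noteq> c" "b \<noteq> c" using ps(1) abc by auto
      let ?D = "Pow {a, b, c} - {{}}"
      have Seq: "S = Pow {a, b, c} - {{}, {a, b, c}}"
        using ne unfolding ps(3) abc cycle_cpx_def by (auto simp: Pow_insert insert_commute)
      have disc: "disc_extending 1 S ?D" using disc_extending_triangle[OF ne] S unfolding Seq by blast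
      have sY: "simplicial_cpx Y" using assms(2) by (simp add: ample_def)
      have top: "\<alpha> ` {a, b, c} \<in> Y" using n3 True vS abc by simp
      have "simplicial_map ?D Y \<alpha>"
        unfolding simplicial_map_def
      proof
        fix \<sigma> assume "\<sigma> \<in> ?D"
        then have "\<alpha> ` \<sigma> \<subseteq> \<alpha> ` {a, b, c}" "\<alpha> ` \<sigma> \<noteq> {}" by blast+
        then show "\<alpha> ` \<sigma> \<in> Y" using simplicial_cpx_face[OF sY top] by blast
      qed
      moreover have "card (vertex_set ?D - vertex_set S) = 0"
      proof -
        have "vertex_set ?D - vertex_set S = {}" unfolding vS abc by (auto simp: vertex_set_def)
        then show ?thesis by (simp only: card.empty)
      qed
      moreover have "card {\<sigma> \<in> ?D. card \<sigma> = 3} \<le> 1"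
      proof -
        have "\<sigma> = {a, b, c}" if "\<sigma> \<in> ?D" "card \<sigma> = 3" for \<sigma>
        proof (rule card_seteq)
          show "\<sigma> \<subseteq> {a, b, c}" using that(1) by blast
          show "card {a, b, c} \<le> card \<sigma>" using that(2) ne by simp
        qed simp
        then have "{\<sigma> \<in> ?D. card \<sigma> = 3} \<subseteq> {{a, b, c}}" by blast
        then have "card {\<sigma> \<in> ?D. card \<sigma> = 3} \<le> card {{a, b, c}}" by (rule card_mono[rotated]) simp
        then show ?thesis by simp
      qed
      ultimately show ?thesis using disc True
        by (intro exI[of _ ?D] exI[of _ \<alpha>]) simp
    next
      case False
      then have n4: "4 \<le> n" using ln ps(2) by simp
      \<comment> \<open>\<open>n \<le> 3 + c * (r - 3)\<close> with \<open>c = Suc k\<close> is the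
        length bound of \<open>fill_loop\<close>; \<open>c\<close> is positive because
        \<open>4 \<le> n\<close>.\<close>
      define c where "c = nat \<lceil>(real n - 3) / (real r - 3)\<rceil>"
      have pos: "0 < (real n - 3) / (real r - 3)" using n4 assms(1) by simp
      have c: "\<lceil>(real n - 3) / (real r - 3)\<rceil> = int c" using pos by (simp add: c_def)
      have "(real n - 3) / (real r - 3) \<le> real c" using c by linarith
      then have "real n - 3 \<le> real c * (real r - 3)" using assms(1) by (simp add: field_simps)
      then have "real n \<le> real (3 + c * (r - 3))" using assms(1) by (simp add: of_nat_diff)
      then have le: "n \<le> 3 + c * (r - 3)" by linarith
      then have "c \<noteq> 0" using n4 by (cases c) auto
      then obtain k where k: "c = Suc k" using not0_implies_Suc by blast
      have len: "4 \<le> length ps" "length ps \<le> 3 + Suc k * (r - 3)"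
        using ln n4 le unfolding k by simp_all
      obtain D \<beta> where D: "disc_extending 1 S D" "simplicial_map D Y \<beta>" "\<forall>v\<in>set ps. \<beta> v = \<alpha> v"
        "card (vertex_set D - set ps) \<le> c" "card {\<sigma> \<in> D. card \<sigma> = 3} \<le> c * (r - 1) + 1"
        using fill_loop[OF assms(2,1) ps(1) len \<alpha>[unfolded ps(3)] finite.emptyI]
        unfolding ps(3) k by blast
      have "int (card {\<sigma> \<in> D. card \<sigma> = 3}) \<le> int (c * (r - 1) + 1)" using D(5) by (simp only: of_nat_le_iff)
      also have "\<dots> = int c * (int r - 1) + 1" using assms(1) by (simp add: of_nat_diff)
      finally show ?thesis using D unfolding c vS by (intro exI[of _ D] exI[of _ \<beta>]) simp
    qed
  qed
  moreover have "simply_connected_cpx Y"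
    unfolding simply_connected_cpx_def m_connected_def
  proof (intro allI impI, elim conjE)
    fix i S and \<alpha> :: "nat \<Rightarrow> 'a"
    assume i: "i \<le> 1" and S: "triangulates_sphere i S" and \<alpha>: "simplicial_map S Y \<alpha>"
    \<comment> \<open>Since \<open>4 \<le> r\<close>, all pairs of points and all loops with three
      vertices fall in the first case, so the condition for \<open>n = 3\<close> holds vacuously in
      the second.\<close>
    show "\<exists>D \<beta>. disc_extending i S D \<and> simplicial_map D Y \<beta> \<and> (\<forall>v\<in>vertex_set S. \<beta> v = \<alpha> v)"
    proof (cases "card (vertex_set S) \<le> r")
      case True
      then show ?thesis using fill_sphere_cone[OF assms(2) S _ \<alpha>] by blast
    next
      case False
      then have big: "3 < card (vertex_set S)" using assms(1) by simp
      have "i \<noteq> 0"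
      proof
        assume "i = 0"
        then have "card (vertex_set S) \<le> 2" using card_vertices_sphere_0 S by simp
        then show False using big by simp
      qed
      then have i1: "i = 1" using i by simp
      have "card (vertex_set S) = 3 \<longrightarrow> \<alpha> ` vertex_set S \<in> Y" using big by simp
      from loops[OF S[unfolded i1] refl \<alpha> this] show ?thesis unfolding i1 by blast
    qed
  qed
  ultimately show ?thesis by blast
qed

end
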